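(* Let $p$ be a prime, $q=p^h$, and let $\omega\in\mathbb{F}_{q^2}$ satisfy $\omega^{q-1}=-1$. (a) Suppose $h\ge 2$ and let $P_\infty$ be the unique point at infinity of the curve $$\sum_{i=1}^{h}Y^{q/p^i}+\omega X^{q+1}=0.$$ Then the Weierstrass semigroup at $P_\infty$ is generated by $\frac{q}{p}$ and $q+1$. (b) Let $d$ be a prime number other than $p$ with $d\mid(q+1)$, and let $P_\infty$ be the unique point at infinity of the curve $$\sum_{i=1}^{h}Y^{q/p^i}+\omega X^{(q+1)/d}=0.$$ Then the Weierstrass semigroup at $P_\infty$ is generated by $\frac{q}{p}$ and $\frac{q+1}{d}$.
   Context: The curves are considered over $\mathbb{F}_{q^2}$ through their function fields $\mathbb{F}_{q^2}(x,y)$, where $x,y$ satisfy the given equation; $P_\infty$ denotes the unique place (point of a non-singular model) centred at infinity, i.e. the unique common pole of $x$ and $y$. The Weierstrass semigroup at $P_\infty$ is the set $H(P_\infty)$ of all non-negative integers $n$ for which there is a function on the curve whose pole divisor is exactly $nP_\infty$. *)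

theory Defs
  imports "HOL-Computational_Algebra.Computational_Algebra" "HOL-Library.Cardinality"
begin

definition field_embedding :: "('k::field \<Rightarrow> 'f::field) \<Rightarrow> bool" where
  "field_embedding \<phi> \<longleftrightarrow> \<phi> 1 = 1 \<and>
     (\<forall>a b. \<phi> (a + b) = \<phi> a + \<phi> b) \<and> (\<forall>a b. \<phi> (a * b) = \<phi> a * \<phi> b)"

definition is_subfield :: "'f::field set \<Rightarrow> bool" where
  "is_subfield S \<longleftrightarrow> 1 \<in> S \<and> (\<forall>a\<in>S. \<forall>b\<in>S. a - b \<in> S) \<and>
     (\<forall>a\<in>S. \<forall>b\<in>S. a * b \<in> S) \<and> (\<forall>a\<in>S. inverse a \<in> S)"

definition transcendental_over :: "('k::field \<Rightarrow> 'f::field) \<Rightarrow> 'f \<Rightarrow> bool" where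
  "transcendental_over \<phi> z \<longleftrightarrow> (\<forall>g::'k poly. g \<noteq> 0 \<longrightarrow> poly (map_poly \<phi> g) z \<noteq> 0)"

text \<open>The type \<open>'f\<close> is the field \<open>K(x, y)\<close>, where \<open>K\<close> is the image of \<open>\<phi>\<close> and \<open>x\<close> is
  transcendental over \<open>K\<close>. An equation between \<open>x\<close> and \<open>y\<close> that is monic in \<open>y\<close> makes it an
  algebraic function field in one variable.\<close>

definition function_field_in :: "('k::field \<Rightarrow> 'f::field) \<Rightarrow> 'f \<Rightarrow> 'f \<Rightarrow> bool" where
  "function_field_in \<phi> x y \<longleftrightarrow> field_embedding \<phi> \<and> transcendental_over \<phi> x \<and>
     is_subfield hull (range \<phi> \<union> {x, y}) = UNIV"

text \<open>A place is identified with its normalised discrete valuation, trivial on the constants.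
  Valuations take values in \<open>int\<close>; instead of \<open>\<infinity>\<close>, the value at \<open>0\<close> is fixed to the dummy \<open>0\<close>,
  so that distinct functions are distinct places.\<close>

definition is_place :: "('k::field \<Rightarrow> 'f::field) \<Rightarrow> ('f \<Rightarrow> int) \<Rightarrow> bool" where
  "is_place \<phi> v \<longleftrightarrow> v 0 = 0 \<and>
     (\<forall>a b. a \<noteq> 0 \<longrightarrow> b \<noteq> 0 \<longrightarrow> v (a * b) = v a + v b) \<and>
     (\<forall>a b. a \<noteq> 0 \<longrightarrow> b \<noteq> 0 \<longrightarrow> a + b \<noteq> 0 \<longrightarrow> v (a + b) \<ge> min (v a) (v b)) \<and>
     (\<forall>c. c \<noteq> 0 \<longrightarrow> v (\<phi> c) = 0) \<and>
     v ` (- {0}) = UNIV"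

definition common_pole :: "('k::field \<Rightarrow> 'f::field) \<Rightarrow> 'f \<Rightarrow> 'f \<Rightarrow> ('f \<Rightarrow> int) \<Rightarrow> bool" where
  "common_pole \<phi> x y P \<longleftrightarrow> is_place \<phi> P \<and> P x < 0 \<and> P y < 0"

text \<open>Effective divisors are given by their coefficients, extended by \<open>0\<close> to functions that are
  not places.\<close>

definition pole_divisor :: "('k::field \<Rightarrow> 'f::field) \<Rightarrow> 'f \<Rightarrow> ('f \<Rightarrow> int) \<Rightarrow> nat" where
  "pole_divisor \<phi> f = (\<lambda>v. if is_place \<phi> v then nat (- v f) else 0)"

definition weierstrass_semigroup :: "('k::field \<Rightarrow> 'f::field) \<Rightarrow> ('f \<Rightarrow> int) \<Rightarrow> nat set" where
  "weierstrass_semigroup \<phi> P =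
     {n. \<exists>f. f \<noteq> 0 \<and> pole_divisor \<phi> f = (\<lambda>v. if v = P then n else 0)}"

definition semigroup_generated :: "nat set \<Rightarrow> nat set" where
  "semigroup_generated A = (\<lambda>S. 0 \<in> S \<and> (\<forall>a\<in>S. \<forall>b\<in>S. a + b \<in> S)) hull A"

end

theory Submission
  imports Defs
begin

text \<open>Write \<open>K\<close> for the field of constants, \<open>n = q / p\<close>, and \<open>m\<close> for the exponent of \<open>x\<close>. The
polynomial \<open>L(T) = \<Sum>T ^ (p ^ i)\<close>, with \<open>i < h\<close>, is monic of degree \<open>n\<close> and additive, and all its
roots lie in \<open>K\<close> (lemma \<open>card_roots_trace_poly\<close>). So the equation \<open>L(y) = - \<omega> x ^ m\<close> has the
\<open>n\<close> solutions \<open>y + \<alpha>\<close> with \<open>L(\<alpha>) = 0\<close>, which differ by constants, and \<open>n\<close> and \<open>m\<close>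
are coprime. These are the properties that the proof uses; they are collected in the locale
\<open>translation_curve\<close>.

At a pole \<open>v\<close> of \<open>x\<close> the equation gives \<open>n * v y = m * v x\<close>, hence \<open>v x = - k * n\<close> and
\<open>v y = - k * m\<close> for some \<open>k > 0\<close>. The field consists of the elements \<open>f = \<Sum>a\<^sub>j(x) y ^ j\<close> with
\<open>j < n\<close> and \<open>a\<^sub>j\<close> in \<open>K(x)\<close>, and the non-zero terms of such a sum have pairwise different values
(lemma \<open>pole_order\<close>). So \<open>v\<close> is determined up to the factor \<open>k\<close>, and \<open>k = 1\<close> as \<open>v\<close> is
normalised. This makes the pole \<open>P\<close> of \<open>x\<close> unique. It also shows that a polynomial in \<open>x\<close> and
\<open>y\<close> has a pole order at \<open>P\<close> of the form \<open>n * i + m * j\<close>.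

It remains to see that a function \<open>f\<close> without poles outside \<open>P\<close> is a polynomial in \<open>x\<close> and
\<open>y\<close> (theorem \<open>regular_functions\<close>). Such an \<open>f\<close> is integral over \<open>K[x]\<close>, and so are its conjugates
under \<open>y \<mapsto> y + \<alpha>\<close>. The \<open>a\<^sub>j\<close> are obtained from the \<open>n\<close> conjugates by interpolation at
the points \<open>y + \<alpha>\<close>; only differences of these points are inverted, and they are constants.
So the \<open>a\<^sub>j\<close> have no poles except at \<open>P\<close>, and rational functions of \<open>x\<close> with this property are
polynomials.

The argument needs enough places: a pole of \<open>x\<close>, a zero of every non-constant polynomial in \<open>x\<close>, and
for every function that is not integral over \<open>K[x]\<close> a pole away from \<open>P\<close>. They come from
Chevalley's extension theorem (theorem \<open>valuation_ring_exists\<close>). That valuation rings which contain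
\<open>K\<close> are discrete (theorem \<open>place_of_valuation_ring\<close>) follows from the fact that every function
satisfies an equation of degree at most \<open>n\<close> over \<open>K(x)\<close>.\<close>

section \<open>Subrings and the polynomials over them\<close>

definition subring :: "'f::field set \<Rightarrow> bool" where
  "subring A \<longleftrightarrow> 1 \<in> A \<and> (\<forall>a\<in>A. \<forall>b\<in>A. a - b \<in> A) \<and> (\<forall>a\<in>A. \<forall>b\<in>A. a * b \<in> A)"

lemma subring_one: "subring A \<Longrightarrow> 1 \<in> A"
  and subring_diff: "subring A \<Longrightarrow> a \<in> A \<Longrightarrow> b \<in> A \<Longrightarrow> a - b \<in> A"
  and subring_mult: "subring A \<Longrightarrow> a \<in> A \<Longrightarrow> b \<in> A \<Longrightarrow> a * b \<in> A"
  by (auto simp: subring_def)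

lemma subring_zero: "subring A \<Longrightarrow> 0 \<in> A"
  using subring_diff[of A 1 1] subring_one by auto

lemma subring_uminus: "subring A \<Longrightarrow> a \<in> A \<Longrightarrow> - a \<in> A"
  using subring_diff[of A 0 a] subring_zero by auto

lemma subring_add: "subring A \<Longrightarrow> a \<in> A \<Longrightarrow> b \<in> A \<Longrightarrow> a + b \<in> A"
  using subring_diff[of A a "- b"] subring_uminus by auto

lemma subring_power: "subring A \<Longrightarrow> a \<in> A \<Longrightarrow> a ^ n \<in> A"
  by (induction n) (auto intro: subring_one subring_mult)

lemma subring_sum: "subring A \<Longrightarrow> (\<And>i. i \<in> I \<Longrightarrow> f i \<in> A) \<Longrightarrow> sum f I \<in> A"
  by (induction I rule: infinite_finite_induct) (auto intro: subring_zero subring_add)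

lemmas subring_closed = subring_zero subring_one subring_add subring_diff subring_uminus
  subring_mult subring_power

definition polys_over :: "'f::field set \<Rightarrow> 'f poly set" where
  "polys_over A = {g. \<forall>i. coeff g i \<in> A}"

lemma polys_over_add: "subring A \<Longrightarrow> g \<in> polys_over A \<Longrightarrow> h \<in> polys_over A \<Longrightarrow> g + h \<in> polys_over A"
  and polys_over_diff: "subring A \<Longrightarrow> g \<in> polys_over A \<Longrightarrow> h \<in> polys_over A \<Longrightarrow> g - h \<in> polys_over A"
  and polys_over_mult: "subring A \<Longrightarrow> g \<in> polys_over A \<Longrightarrow> h \<in> polys_over A \<Longrightarrow> g * h \<in> polys_over A"
  and polys_over_const: "subring A \<Longrightarrow> a \<in> A \<Longrightarrow> [:a:] \<in> polys_over A"
  and polys_over_monom: "subring A \<Longrightarrow> a \<in> A \<Longrightarrow> monom a n \<in> polys_over A"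
  and polys_over_smult: "subring A \<Longrightarrow> a \<in> A \<Longrightarrow> g \<in> polys_over A \<Longrightarrow> smult a g \<in> polys_over A"
  by (auto simp: polys_over_def coeff_mult coeff_pCons subring_closed intro!: subring_sum split: nat.splits)

lemma polys_over_sum:
  "subring A \<Longrightarrow> (\<And>i. i \<in> I \<Longrightarrow> g i \<in> polys_over A) \<Longrightarrow> sum g I \<in> polys_over A"
  by (auto simp: polys_over_def coeff_sum intro!: subring_sum)

lemma polys_over_power: "subring A \<Longrightarrow> g \<in> polys_over A \<Longrightarrow> g ^ n \<in> polys_over A"
  using polys_over_const[of A 1] subring_one[of A]
  by (induction n) (auto simp: one_pCons intro: polys_over_mult)

lemma poly_in_subring: "subring A \<Longrightarrow> g \<in> polys_over A \<Longrightarrow> a \<in> A \<Longrightarrow> poly g a \<in> A"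
  unfolding poly_altdef by (intro subring_sum) (auto simp: polys_over_def subring_closed)

definition adjoin :: "'f::field set \<Rightarrow> 'f \<Rightarrow> 'f set" where
  "adjoin A f = (\<lambda>g. poly g f) ` polys_over A"

lemma subring_adjoin: assumes A: "subring A" shows "subring (adjoin A f)"
  unfolding subring_def
proof (intro conjI ballI)
  show "1 \<in> adjoin A f" unfolding adjoin_def
    using polys_over_const[OF A subring_one[OF A]] by (auto intro!: image_eqI[where x = "[:1:]"])
next
  fix a b assume "a \<in> adjoin A f" "b \<in> adjoin A f"
  then obtain g h where gh: "g \<in> polys_over A" "h \<in> polys_over A" "a = poly g f" "b = poly h f"
    by (auto simp: adjoin_def)
  show "a - b \<in> adjoin A f" unfolding adjoin_def
    using gh polys_over_diff[OF A gh(1,2)] by (auto intro!: image_eqI[where x = "g - h"])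
  show "a * b \<in> adjoin A f" unfolding adjoin_def
    using gh polys_over_mult[OF A gh(1,2)] by (auto intro!: image_eqI[where x = "g * h"])
qed

lemma adjoin_superset: assumes A: "subring A" shows "A \<subseteq> adjoin A f"
proof
  fix a assume "a \<in> A"
  thus "a \<in> adjoin A f" unfolding adjoin_def
    using polys_over_const[OF A] by (auto intro!: image_eqI[where x = "[:a:]"])
qed

lemma adjoin_gen: assumes A: "subring A" shows "f \<in> adjoin A f"
  unfolding adjoin_def using polys_over_monom[OF A subring_one[OF A], of 1]
  by (auto intro!: image_eqI[where x = "monom 1 1"] simp: poly_monom)

section \<open>Extending a subring to a valuation ring\<close>

definition valuation_ring :: "'f::field set \<Rightarrow> bool" where
  "valuation_ring R \<longleftrightarrow> subring R \<and> (\<forall>f. f \<in> R \<or> inverse f \<in> R)"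

text \<open>Multiplied by \<open>f ^ s\<close>, with \<open>s\<close> the degree of \<open>h\<close>, the relation for \<open>inverse f\<close> reads
\<open>f ^ s * (1 - z * coeff h 0) = z * \<dots>\<close>, where only lower powers of \<open>f\<close> occur on the right.
The factor on the left is a unit, so the leading term of \<open>g\<close> can be replaced by terms of lower degree.\<close>

lemma one_relation_reduces:
  fixes f z :: "'f::field"
  assumes R: "subring R" and z: "z \<in> R"
    and unit: "\<And>b. b \<in> R \<Longrightarrow> inverse (1 - z * b) \<in> R \<and> 1 - z * b \<noteq> 0"
    and f: "f \<noteq> 0"
    and g: "g \<in> polys_over R" "1 = z * poly g f"
    and h: "h \<in> polys_over R" "1 = z * poly h (inverse f)"
    and deg: "degree h \<le> degree g" "0 < degree h"
  obtains g' where "g' \<in> polys_over R" "1 = z * poly g' f" "degree g' < degree g"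
proof -
  define r s where "r = degree g" and "s = degree h"
  have s: "0 < s" "s \<le> r" using deg by (auto simp: r_def s_def)
  define u where "u = inverse (1 - z * coeff h 0)"
  have u: "u \<in> R" "u * (1 - z * coeff h 0) = 1"
    using unit[of "coeff h 0"] h(1) by (auto simp: u_def polys_over_def)
  have hs: "poly h (inverse f) = coeff h 0 + (\<Sum>i=1..s. coeff h i * inverse f ^ i)"
  proof -
    have "{..s} = insert 0 {1..s}" by auto
    thus ?thesis by (simp add: poly_altdef s_def)
  qed
  have "f ^ s * (1 - z * coeff h 0) = z * (\<Sum>i=1..s. coeff h i * (f ^ s * inverse f ^ i))"
  proof -
    have "1 - z * coeff h 0 = z * (\<Sum>i=1..s. coeff h i * inverse f ^ i)"
      using h(2) unfolding hs by (simp add: algebra_simps)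
    thus ?thesis by (simp add: sum_distrib_left mult_ac)
  qed
  also have "(\<Sum>i=1..s. coeff h i * (f ^ s * inverse f ^ i)) = (\<Sum>i=1..s. coeff h i * f ^ (s - i))"
    using f by (intro sum.cong refl) (auto simp: power_diff field_simps)
  finally have "u * (f ^ s * (1 - z * coeff h 0)) = u * (z * (\<Sum>i=1..s. coeff h i * f ^ (s - i)))"
    by simp
  moreover have "u * (f ^ s * (1 - z * coeff h 0)) = f ^ s"
    by (simp only: mult.left_commute[of u "f ^ s"] u(2) mult_1_right)
  ultimately have fs: "f ^ s = z * (\<Sum>i=1..s. u * coeff h i * f ^ (s - i))"
    by (simp add: sum_distrib_left mult_ac)
  define k where "k = smult (z * lead_coeff g) (\<Sum>i=1..s. monom (u * coeff h i) (r - i))"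
  define g' where "g' = (\<Sum>i<r. monom (coeff g i) i) + k"
  have gsplit: "g = (\<Sum>i<r. monom (coeff g i) i) + monom (lead_coeff g) r"
    using poly_as_sum_of_monoms[of g] by (simp add: r_def flip: lessThan_Suc_atMost)
  have pk: "poly k f = lead_coeff g * f ^ r"
  proof -
    have "poly k f = lead_coeff g * (z * (\<Sum>i=1..s. u * coeff h i * f ^ (s - i))) * f ^ (r - s)"
    proof -
      have "f ^ (r - i) = f ^ (s - i) * f ^ (r - s)" if "i \<in> {1..s}" for i
      proof -
        have "r - i = (s - i) + (r - s)" using that s by auto
        thus ?thesis by (simp only: power_add)
      qed
      hence "(\<Sum>i=1..s. u * coeff h i * f ^ (r - i))
          = (\<Sum>i=1..s. u * coeff h i * (f ^ (s - i) * f ^ (r - s)))"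
        by (intro sum.cong refl arg_cong2[where f = "(*)"])
      moreover have "poly k f = z * lead_coeff g * (\<Sum>i=1..s. u * coeff h i * f ^ (r - i))"
        by (simp add: k_def poly_sum poly_monom)
      ultimately have "poly k f
          = z * lead_coeff g * (\<Sum>i=1..s. u * coeff h i * (f ^ (s - i) * f ^ (r - s)))"
        by simp
      thus ?thesis by (simp add: sum_distrib_left sum_distrib_right mult_ac)
    qed
    also have "\<dots> = lead_coeff g * (f ^ s * f ^ (r - s))"
      unfolding fs[symmetric] by (simp add: mult_ac)
    also have "f ^ s * f ^ (r - s) = f ^ r" using s by (simp flip: power_add)
    finally show ?thesis .
  qed
  have pg': "poly g' f = poly g f"
    by (subst gsplit) (simp add: g'_def pk poly_monom)
  have "degree g' < r"
  proof -
    have "degree (\<Sum>i<r. monom (coeff g i) i) \<le> r - 1"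
      using s by (intro degree_sum_le) (auto intro!: order.trans[OF degree_monom_le])
    moreover have "degree k \<le> r - 1" unfolding k_def
      using s by (intro order.trans[OF degree_smult_le] degree_sum_le)
        (auto intro!: order.trans[OF degree_monom_le])
    ultimately have "degree g' \<le> r - 1" unfolding g'_def by (rule degree_add_le)
    thus ?thesis using s by auto
  qed
  moreover have "g' \<in> polys_over R"
    using R z g(1) h(1) u(1) unfolding g'_def k_def
    by (intro polys_over_add polys_over_sum polys_over_smult polys_over_monom subring_mult)
      (auto simp: polys_over_def)
  moreover have "1 = z * poly g' f" by (simp only: pg' g(2)[symmetric])
  ultimately show thesis using that[of g'] unfolding r_def by blast
qed

text \<open>This is Chevalley's extension theorem. Among the subrings that contain \<open>A\<close> and in which \<open>z\<close> stays
a non-unit, Zorn's lemma gives a maximal one \<open>R\<close>. Its elements \<open>1 - z * b\<close> are units, because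
inverting one of them does not make \<open>z\<close> invertible. If neither \<open>f\<close> nor \<open>inverse f\<close> were in \<open>R\<close>,
then adjoining either of them would make \<open>z\<close> invertible; of two such relations of least degrees,
the one of smaller degree would shorten the other one.\<close>

theorem valuation_ring_exists:
  assumes A: "subring A" and zA: "z \<in> A" and z: "\<And>a. a \<in> A \<Longrightarrow> z * a \<noteq> 1"
  obtains R where "valuation_ring R" "A \<subseteq> R" "\<And>a. a \<in> R \<Longrightarrow> z * a \<noteq> 1"
proof -
  define \<A> where "\<A> = {R. subring R \<and> A \<subseteq> R \<and> (\<forall>a\<in>R. z * a \<noteq> 1)}"
  have "\<exists>M\<in>\<A>. \<forall>X\<in>\<A>. M \<subseteq> X \<longrightarrow> X = M"
  proof (rule subset_Zorn_nonempty)
    show "\<A> \<noteq> {}" using A z by (auto simp: \<A>_def)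
  next
    fix \<C> assume ne: "\<C> \<noteq> {}" and ch: "subset.chain \<A> \<C>"
    hence sub: "\<C> \<subseteq> \<A>" and tot: "\<And>X Y. X \<in> \<C> \<Longrightarrow> Y \<in> \<C> \<Longrightarrow> X \<subseteq> Y \<or> Y \<subseteq> X"
      by (auto simp: subset_chain_def)
    have two: "\<exists>X\<in>\<C>. a \<in> X \<and> b \<in> X" if "a \<in> \<Union>\<C>" "b \<in> \<Union>\<C>" for a b
      using that tot by blast
    have "subring (\<Union>\<C>)"
      unfolding subring_def
    proof (intro conjI ballI)
      show "1 \<in> \<Union>\<C>" using ne sub subring_one by (auto simp: \<A>_def)
      fix a b assume "a \<in> \<Union>\<C>" "b \<in> \<Union>\<C>"
      then obtain X where "X \<in> \<C>" "a \<in> X" "b \<in> X" using two by blast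
      moreover from this have "subring X" using sub by (auto simp: \<A>_def)
      ultimately show "a - b \<in> \<Union>\<C>" "a * b \<in> \<Union>\<C>"
        using subring_diff subring_mult by blast+
    qed
    moreover have "A \<subseteq> \<Union>\<C>" using ne sub by (auto simp: \<A>_def)
    moreover have "\<forall>a\<in>\<Union>\<C>. z * a \<noteq> 1" using sub by (auto simp: \<A>_def)
    ultimately show "\<Union>\<C> \<in> \<A>" by (auto simp: \<A>_def)
  qed
  then obtain R where RA: "R \<in> \<A>" and max: "\<And>X. X \<in> \<A> \<Longrightarrow> R \<subseteq> X \<Longrightarrow> X = R" by blast
  have R: "subring R" "A \<subseteq> R" "\<And>a. a \<in> R \<Longrightarrow> z * a \<noteq> 1" using RA by (auto simp: \<A>_def)
  have zR: "z \<in> R" using zA R(2) by auto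
  have rel: "\<exists>g\<in>polys_over R. 1 = z * poly g f" if "f \<notin> R" for f
  proof (rule ccontr)
    assume "\<not> ?thesis"
    hence "adjoin R f \<in> \<A>"
      using subring_adjoin[OF R(1)] adjoin_superset[OF R(1)] R(2)
      by (fastforce simp: \<A>_def adjoin_def)
    hence "adjoin R f = R" using max adjoin_superset[OF R(1)] by blast
    thus False using adjoin_gen[OF R(1), of f] that by auto
  qed
  have unit: "inverse (1 - z * b) \<in> R \<and> 1 - z * b \<noteq> 0" if b: "b \<in> R" for b
  proof (rule ccontr)
    assume asm: "\<not> ?thesis"
    have nz: "1 - z * b \<noteq> 0" using R(3)[OF b] by auto
    with asm have "inverse (1 - z * b) \<notin> R" by auto
    from rel[OF this] obtain g where g: "g \<in> polys_over R" "1 = z * poly g (inverse (1 - z * b))"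
      by blast
    define d where "d = degree g"
    \<comment> \<open>Clearing denominators gives \<open>(1 - z * b) ^ d \<in> z * R\<close>, but that power is \<open>1\<close> modulo \<open>z\<close>.\<close>
    have "(1 - z * b) ^ d = z * (\<Sum>i\<le>d. coeff g i * (inverse (1 - z * b) ^ i * (1 - z * b) ^ d))"
    proof -
      have "(1 - z * b) ^ d = z * poly g (inverse (1 - z * b)) * (1 - z * b) ^ d"
        using g(2) by simp
      thus ?thesis
        by (simp add: poly_altdef d_def sum_distrib_left sum_distrib_right mult_ac)
    qed
    also have "(\<Sum>i\<le>d. coeff g i * (inverse (1 - z * b) ^ i * (1 - z * b) ^ d))
        = (\<Sum>i\<le>d. coeff g i * (1 - z * b) ^ (d - i))"
      using nz by (intro sum.cong refl) (auto simp: power_diff field_simps)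
    finally have e1: "(1 - z * b) ^ d = z * (\<Sum>i\<le>d. coeff g i * (1 - z * b) ^ (d - i))" .
    have "\<exists>c\<in>R. (1 - z * b) ^ d = 1 - z * c"
    proof (induction d)
      case 0 show ?case using subring_zero[OF R(1)] by (intro bexI[of _ 0]) auto
    next
      case (Suc d)
      then obtain c where c: "c \<in> R" "(1 - z * b) ^ d = 1 - z * c" by blast
      have "(1 - z * b) ^ Suc d = 1 - z * (b + c - z * b * c)"
        unfolding power_Suc c(2) by (simp add: algebra_simps)
      thus ?case using c(1) b zR R(1) by (blast intro: subring_closed)
    qed
    then obtain c where c: "c \<in> R" "(1 - z * b) ^ d = 1 - z * c" by blast
    have "z * ((\<Sum>i\<le>d. coeff g i * (1 - z * b) ^ (d - i)) + c) = 1"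
      using e1 c(2) by (simp add: algebra_simps)
    moreover have "(\<Sum>i\<le>d. coeff g i * (1 - z * b) ^ (d - i)) + c \<in> R"
      using g(1) R(1) b c(1) zR
      by (intro subring_add subring_sum subring_mult subring_power subring_diff subring_one)
        (auto simp: polys_over_def)
    ultimately show False using R(3) by blast
  qed
  have "f \<in> R \<or> inverse f \<in> R" for f
  proof (rule ccontr)
    assume asm: "\<not> ?thesis"
    define G where "G = (\<lambda>f g. g \<in> polys_over R \<and> 1 = z * poly g f)"
    have min: "\<exists>g. G f g \<and> (\<forall>g'. G f g' \<longrightarrow> degree g \<le> degree g')" if "f \<notin> R" for f
      using rel[OF that] ex_has_least_nat[of "G f" _ degree] by (auto simp: G_def)
    obtain g where g: "G f g" "\<And>g'. G f g' \<Longrightarrow> degree g \<le> degree g'" using min asm by blast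
    obtain h where h: "G (inverse f) h" "\<And>g'. G (inverse f) g' \<Longrightarrow> degree h \<le> degree g'"
      using min asm by blast
    have f0: "f \<noteq> 0" using asm subring_zero[OF R(1)] by auto
    have pos: "0 < degree k" if "G t k" for t k
    proof (rule ccontr)
      assume "\<not> ?thesis"
      then obtain a where "k = [:a:]" by (auto elim: degree_eq_zeroE)
      hence "a \<in> R" "z * a = 1" using that by (auto simp: G_def polys_over_def dest: spec[of _ 0])
      thus False using R(3) by blast
    qed
    show False
    proof (cases "degree h \<le> degree g")
      case True
      from one_relation_reduces[OF R(1) zR unit f0 _ _ _ _ True pos[OF h(1)]] g(1) h(1)
      obtain g' where "G f g'" "degree g' < degree g" unfolding G_def by blast
      thus False using g(2) by (auto simp: not_less[symmetric])
    next
      case False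
      hence le: "degree g \<le> degree h" by simp
      have i: "inverse f \<noteq> 0" "G (inverse (inverse f)) g" using f0 g(1) by auto
      from one_relation_reduces[OF R(1) zR unit i(1) _ _ _ _ le pos[OF g(1)]] i(2) h(1)
      obtain g' where "G (inverse f) g'" "degree g' < degree h" unfolding G_def by blast
      thus False using h(2) by (auto simp: not_less[symmetric])
    qed
  qed
  hence "valuation_ring R" using R(1) by (auto simp: valuation_ring_def)
  thus thesis using that R by blast
qed

section \<open>Discrete valuations from valuation rings\<close>

text \<open>The condition \<open>u \<noteq> 0\<close> matters, since \<open>inverse 0 = 0\<close> is an element of every subring.\<close>

definition units :: "'f::field set \<Rightarrow> 'f set" where
  "units R = {u \<in> R. u \<noteq> 0 \<and> inverse u \<in> R}"

lemma units_mult: "subring R \<Longrightarrow> a \<in> units R \<Longrightarrow> b \<in> units R \<Longrightarrow> a * b \<in> units R"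
  by (auto simp: units_def subring_mult)

lemma units_inverse: "a \<in> units R \<Longrightarrow> inverse a \<in> units R"
  by (auto simp: units_def)

lemma units_divide: "subring R \<Longrightarrow> a \<in> units R \<Longrightarrow> b \<in> units R \<Longrightarrow> a / b \<in> units R"
  unfolding divide_inverse by (intro units_mult units_inverse)

lemma units_power: "subring R \<Longrightarrow> a \<in> units R \<Longrightarrow> a ^ n \<in> units R"
  by (auto simp: units_def subring_power simp flip: power_inverse)

lemma units_factor:
  assumes R: "subring R" and "a \<in> R" "b \<in> R" "a * b \<in> units R"
  shows "a \<in> units R"
proof -
  have nz: "a \<noteq> 0" "b \<noteq> 0" using assms(4) by (auto simp: units_def)
  hence ia: "inverse a = b * inverse (a * b)" by simp
  have "inverse a \<in> R"
    unfolding ia using assms by (intro subring_mult) (auto simp: units_def)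
  thus ?thesis using assms(2) nz by (simp add: units_def)
qed

lemma valuation_ring_subring: "valuation_ring R \<Longrightarrow> subring R"
  by (simp add: valuation_ring_def)

text \<open>A valuation ring is local: of two non-units one divides the other, and hence divides the sum.\<close>

lemma nonunits_add:
  assumes R: "valuation_ring R" and a: "a \<in> R - units R" and b: "b \<in> R - units R"
  shows "a + b \<in> R - units R"
proof -
  note S = valuation_ring_subring[OF R]
  have *: "a + b \<notin> units R" if "a \<in> R - units R" "b \<in> R - units R" "b / a \<in> R" "a \<noteq> 0" for a b
  proof
    assume "a + b \<in> units R"
    moreover have "a + b = a * (1 + b / a)" using that by (simp add: field_simps)
    ultimately show False
      using units_factor[OF S, of a "1 + b / a"] that subring_add[OF S subring_one[OF S]] by auto
  qed
  have "a + b \<notin> units R"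
  proof (cases "a = 0 \<or> b = 0")
    case False
    have "b / a \<in> R \<or> inverse (b / a) \<in> R" using R by (auto simp: valuation_ring_def)
    thus ?thesis using *[of a b] *[of b a] a b False by (auto simp: add.commute)
  qed (use a b in auto)
  thus ?thesis using a b subring_add[OF S] by auto
qed

lemma one_plus_nonunit:
  assumes R: "valuation_ring R" and a: "a \<in> R - units R"
  shows "1 + a \<in> units R"
proof (rule ccontr)
  note S = valuation_ring_subring[OF R]
  have ma: "- a \<in> R - units R" using a by (auto simp: units_def subring_uminus[OF S])
       (metis S minus_minus subring_uminus)
  assume "1 + a \<notin> units R"
  hence "1 + a \<in> R - units R" using a subring_add[OF S subring_one[OF S]] by auto
  from nonunits_add[OF R this ma] have "1 \<notin> units R" by simp
  thus False using subring_one[OF S] by (auto simp: units_def)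
qed

text \<open>The least value is attained by at least two terms: otherwise, after division by the
  unique term of least value, the sum is \<open>1\<close> plus a non-unit.\<close>

lemma zero_sum_two_minimal_terms:
  assumes R: "valuation_ring R" and fin: "finite I" and i0: "i\<^sub>0 \<in> I" "t i\<^sub>0 \<noteq> 0"
    and sum: "(\<Sum>i\<in>I. t i) = (0::'f::field)"
  obtains i j where "i \<in> I" "j \<in> I" "i \<noteq> j" "t i / t j \<in> units R" "t j \<noteq> 0"
proof -
  note S = valuation_ring_subring[OF R]
  define J where "J = {i \<in> I. t i \<noteq> 0}"
  have J: "finite J" "J \<noteq> {}" using fin i0 by (auto simp: J_def)
  have "\<exists>j\<in>J. \<forall>i\<in>J. t i / t j \<in> R"
    using J(1,2)
  proof (induction J rule: finite_ne_induct)
    case (singleton j)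
    show ?case using subring_one[OF S] subring_zero[OF S] by (cases "t j = 0") auto
  next
    case (insert k J)
    then obtain j where j: "j \<in> J" "\<forall>i\<in>J. t i / t j \<in> R" by blast
    show ?case
    proof (cases "t k / t j \<in> R")
      case True
      thus ?thesis using j by blast
    next
      case False
      hence nz: "t j \<noteq> 0" using subring_zero[OF S] by auto
      have "t j / t k \<in> R" using False R by (metis inverse_divide valuation_ring_def)
      hence "t i / t k \<in> R" if "i \<in> J" for i
        using subring_mult[OF S, of "t i / t j" "t j / t k"] j that nz by auto
      moreover have "t k / t k \<in> R" using subring_one[OF S] subring_zero[OF S] by (cases "t k = 0") auto
      ultimately show ?thesis by blast
    qed
  qed
  then obtain j where j: "j \<in> J" "\<And>i. i \<in> J \<Longrightarrow> t i / t j \<in> R" by blast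
  have nz: "t j \<noteq> 0" "j \<in> I" using j by (auto simp: J_def)
  have "\<exists>i\<in>J - {j}. t i / t j \<in> units R"
  proof (rule ccontr)
    assume none: "\<not> ?thesis"
    have "(\<Sum>i\<in>K. t i / t j) \<in> R - units R" if "K \<subseteq> J - {j}" for K
      using finite_subset[OF that] J(1) that
    proof (induction K rule: infinite_finite_induct)
      case (insert k K)
      thus ?case using none j nonunits_add[OF R] by auto
    qed (use subring_zero[OF S] in \<open>auto simp: units_def\<close>)
    hence "1 + (\<Sum>i\<in>J-{j}. t i / t j) \<in> units R" by (intro one_plus_nonunit[OF R]) auto
    moreover have "1 + (\<Sum>i\<in>J-{j}. t i / t j) = (\<Sum>i\<in>J. t i / t j)"
      using J(1) j(1) nz by (simp add: sum.remove)
    moreover have "(\<Sum>i\<in>J. t i / t j) = (\<Sum>i\<in>I. t i) / t j"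
      unfolding sum_divide_distrib using fin by (intro sum.mono_neutral_left) (auto simp: J_def)
    ultimately show False using sum by (simp add: units_def)
  qed
  then obtain i where "i \<in> J" "i \<noteq> j" "t i / t j \<in> units R" by blast
  thus thesis using that nz by (auto simp: J_def)
qed

text \<open>These are the conditions on a place that do not involve the constants; as there, the value at \<open>0\<close> is
a dummy.\<close>

definition discrete_valuation :: "('f::field \<Rightarrow> int) \<Rightarrow> bool" where
  "discrete_valuation v \<longleftrightarrow> v 0 = 0 \<and>
     (\<forall>a b. a \<noteq> 0 \<longrightarrow> b \<noteq> 0 \<longrightarrow> v (a * b) = v a + v b) \<and>
     (\<forall>a b. a \<noteq> 0 \<longrightarrow> b \<noteq> 0 \<longrightarrow> a + b \<noteq> 0 \<longrightarrow> v (a + b) \<ge> min (v a) (v b)) \<and>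
     v ` (- {0}) = UNIV"

text \<open>The hypothesis says that the value group lies between \<open>\<int>\<close> (generated by the value of
  \<open>z\<close>) and \<open>(1/N) \<int>\<close>. So \<open>N\<close> times the value is an integer \<open>w f\<close>, and dividing \<open>w\<close> by its
  least positive value gives the normalised valuation.\<close>

theorem discrete_valuation_of_valuation_ring:
  fixes z :: "'f::field"
  assumes R: "valuation_ring R" and z: "z \<in> R" "z \<noteq> 0" "inverse z \<notin> R" and N: "N > 0"
    and ex: "\<And>f. f \<noteq> 0 \<Longrightarrow> \<exists>k::int. f ^ N / z powi k \<in> units R"
  obtains v where "discrete_valuation v" "\<And>f. f \<noteq> 0 \<Longrightarrow> v f \<ge> 0 \<longleftrightarrow> f \<in> R"
proof -
  note S = valuation_ring_subring[OF R]
  obtain w where w: "\<And>f. f \<noteq> 0 \<Longrightarrow> f ^ N / z powi (w f) \<in> units R" using ex by metis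
  have z_nonunit: "z \<notin> units R" using z by (auto simp: units_def)
  have zpos: "k = 0" if "z ^ k \<in> units R" for k :: nat
    using that z_nonunit units_factor[OF S, of z "z ^ (k - 1)"] z(1) S
    by (cases k) (auto intro: subring_power)
  have zk: "k = 0" if "z powi k \<in> units R" for k :: int
  proof (cases "k \<ge> 0")
    case True
    thus ?thesis using zpos[of "nat k"] that by (auto simp: power_int_def)
  next
    case False
    thus ?thesis using zpos[of "nat (- k)"] units_inverse[OF that]
      by (auto simp: power_int_def power_inverse)
  qed
  have uniq: "w f = a" if "f \<noteq> 0" "f ^ N / z powi a \<in> units R" for f a
  proof -
    have "(f ^ N / z powi a) / (f ^ N / z powi (w f)) = z powi (w f - a)"
      using that(1) z(2) by (simp add: power_int_diff)
    thus ?thesis using units_divide[OF S that(2) w[OF that(1)]] zk[of "w f - a"] by simp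
  qed
  have w_mult: "w (f * g) = w f + w g" if "f \<noteq> 0" "g \<noteq> 0" for f g
  proof (rule uniq)
    have "(f * g) ^ N / z powi (w f + w g) = (f ^ N / z powi w f) * (g ^ N / z powi w g)"
      using z(2) by (simp add: power_int_add power_mult_distrib)
    thus "(f * g) ^ N / z powi (w f + w g) \<in> units R"
      using units_mult[OF S w[OF that(1)] w[OF that(2)]] by simp
  qed (use that in auto)
  have w_one: "w 1 = 0" using w_mult[of 1 1] by simp
  have w_inv: "w (inverse f) = - w f" if "f \<noteq> 0" for f
    using w_mult[of f "inverse f"] that w_one by simp
  have w_z: "w z = int N"
    using z(2) subring_one[OF S] by (intro uniq) (auto simp: units_def)
  have w_pow: "w (f ^ k) = int k * w f" if "f \<noteq> 0" for f k
    using that by (induction k) (auto simp: w_one w_mult algebra_simps)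
  have w_powi: "w (f powi k) = k * w f" if "f \<noteq> 0" for f k
    using that w_pow[of f "nat k"] w_pow[of "inverse f" "nat (- k)"] w_inv[of f]
    by (auto simp: power_int_def)
  have w_R: "w f \<ge> 0" if f: "f \<in> R" "f \<noteq> 0" for f
  proof (rule ccontr)
    assume "\<not> ?thesis"
    then obtain k where k: "w f = - int (Suc k)" by (metis negD not_le_imp_less)
    have "z * (z ^ k * f ^ N) = f ^ N / z powi w f"
      unfolding k by (simp add: power_int_minus field_simps power_int_add z(2) del: of_nat_Suc)
    moreover have "z ^ k * f ^ N \<in> R" using f z(1) S by (auto intro: subring_closed)
    ultimately have "z \<in> units R" using units_factor[OF S z(1)] w[OF f(2)] by metis
    thus False using z_nonunit by simp
  qed
  have R_w: "f \<in> R" if f: "w f \<ge> 0" "f \<noteq> 0" for f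
  proof (rule ccontr)
    assume nf: "f \<notin> R"
    hence i: "inverse f \<in> R" using R by (auto simp: valuation_ring_def)
    hence "w (inverse f) \<ge> 0" using w_R f(2) by auto
    hence "w f = 0" using w_inv f by auto
    hence "f ^ N \<in> R" using w[OF f(2)] by (simp add: units_def)
    hence "f ^ N * inverse f ^ (N - 1) \<in> R" using i S by (auto intro: subring_closed)
    moreover have "f ^ N * inverse f ^ (N - 1) = f"
    proof -
      have "f ^ N = f * f ^ (N - 1)" using N by (cases N) auto
      moreover have "f ^ (N - 1) * inverse f ^ (N - 1) = 1"
        using f(2) by (simp add: power_inverse)
      ultimately show ?thesis by (simp only: mult.assoc mult_1_right)
    qed
    ultimately show False using nf by simp
  qed
  have w_ultra: "w f \<le> w (f + g)" if "f \<noteq> 0" "g \<noteq> 0" "f + g \<noteq> 0" "w f \<le> w g" for f g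
  proof -
    have "w (g / f) \<ge> 0" using that w_mult[of g "inverse f"] w_inv by (simp add: divide_inverse)
    hence "1 + g / f \<in> R" using R_w[of "g / f"] that subring_add[OF S subring_one[OF S]] by auto
    moreover have fg: "f + g = f * (1 + g / f)" using that by (simp add: field_simps)
    moreover from this have "1 + g / f \<noteq> 0" using that by auto
    ultimately have "w (1 + g / f) \<ge> 0" using w_R by blast
    thus ?thesis unfolding fg using w_mult[OF that(1) \<open>1 + g / f \<noteq> 0\<close>] by simp
  qed
  \<comment> \<open>Divisibility by the least positive value normalises \<open>w\<close>.\<close>
  define e where "e = (LEAST n. n > 0 \<and> (\<exists>f. f \<noteq> 0 \<and> w f = int n))"
  have "N > 0 \<and> (\<exists>f. f \<noteq> 0 \<and> w f = int N)" using N z(2) w_z by auto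
  from LeastI[of "\<lambda>n. n > 0 \<and> (\<exists>f. f \<noteq> 0 \<and> w f = int n)", OF this]
  obtain t where t: "e > 0" "t \<noteq> 0" "w t = int e" by (auto simp: e_def)
  have e_dvd: "int e dvd w f" if "f \<noteq> 0" for f
  proof (rule ccontr)
    assume "\<not> ?thesis"
    hence "w f mod int e \<noteq> 0" by (auto dest: mod_0_imp_dvd)
    moreover have "w f mod int e \<ge> 0" using t(1) by simp
    ultimately have pos: "w f mod int e > 0" by simp
    define g where "g = f * t powi (- (w f div int e))"
    have g: "g \<noteq> 0" using that t(2) by (simp add: g_def)
    have "w g = w f - (w f div int e) * int e"
      using that t by (simp add: g_def w_mult w_powi)
    also have "\<dots> = int (nat (w f mod int e))" using pos by (simp add: minus_div_mult_eq_mod)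
    finally have "e \<le> nat (w f mod int e)"
      unfolding e_def by (intro Least_le) (use g pos in \<open>auto simp: e_def\<close>)
    moreover have "w f mod int e < int e" using t(1) by simp
    ultimately show False using pos by linarith
  qed
  define v where "v = (\<lambda>f. if f = 0 then 0 else w f div int e)"
  have v: "w f = int e * v f" if "f \<noteq> 0" for f using e_dvd that by (simp add: v_def)
  have ie: "int e > 0" using t(1) by simp
  show thesis
  proof (rule that[of v])
    show "discrete_valuation v" unfolding discrete_valuation_def
    proof (intro conjI allI impI)
      show "v 0 = 0" by (simp add: v_def)
    next
      fix a b :: 'f assume "a \<noteq> 0" "b \<noteq> 0"
      hence "int e * v (a * b) = int e * (v a + v b)"
        using v[of a] v[of b] v[of "a * b"] w_mult[of a b] by (simp add: algebra_simps)
      thus "v (a * b) = v a + v b" using ie by simp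
    next
      fix a b :: 'f assume "a \<noteq> 0" "b \<noteq> 0" "a + b \<noteq> 0"
      hence "int e * v a \<le> int e * v (a + b) \<or> int e * v b \<le> int e * v (a + b)"
        using v[of a] v[of b] v[of "a + b"] w_ultra[of a b] w_ultra[of b a]
        by (cases "w a \<le> w b") (auto simp: add.commute)
      thus "min (v a) (v b) \<le> v (a + b)" using ie by (auto simp: min_le_iff_disj)
    next
      have "k \<in> v ` (- {0})" for k
      proof (rule image_eqI)
        show "k = v (t powi k)" using t by (simp add: v_def w_powi)
      qed (use t in auto)
      thus "v ` (- {0}) = UNIV" by blast
    qed
    show "v f \<ge> 0 \<longleftrightarrow> f \<in> R" if "f \<noteq> 0" for f
      using w_R[of f] R_w[of f] that v[OF that] ie by (auto simp: zero_le_mult_iff)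
  qed
qed

section \<open>Valuation rings that contain the constants\<close>

locale constant_field =
  fixes \<phi> :: "'k::field \<Rightarrow> 'f::field"
  assumes embedding: "field_embedding \<phi>"
begin

lemma \<phi>_one: "\<phi> 1 = 1" and \<phi>_add: "\<phi> (a + b) = \<phi> a + \<phi> b" and \<phi>_mult: "\<phi> (a * b) = \<phi> a * \<phi> b"
  using embedding by (auto simp: field_embedding_def)

lemma \<phi>_zero [simp]: "\<phi> 0 = 0"
  using \<phi>_add[of 0 0] by (metis add_0 add_cancel_left_left)

lemma \<phi>_uminus: "\<phi> (- a) = - \<phi> a"
  using \<phi>_add[of a "- a"] \<phi>_zero by (simp add: add_eq_0_iff)

lemma \<phi>_diff: "\<phi> (a - b) = \<phi> a - \<phi> b"
  using \<phi>_add[of a "- b"] \<phi>_uminus by simp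

lemma \<phi>_power: "\<phi> (a ^ n) = \<phi> a ^ n"
  by (induction n) (auto simp: \<phi>_one \<phi>_mult)

lemma \<phi>_inverse: "\<phi> (inverse a) = inverse (\<phi> a)"
proof (cases "a = 0")
  case False
  hence "\<phi> a * \<phi> (inverse a) = 1" by (simp add: \<phi>_one flip: \<phi>_mult)
  thus ?thesis by (metis inverse_unique)
qed (auto simp: \<phi>_zero)

lemma \<phi>_eq_0_iff: "\<phi> a = 0 \<longleftrightarrow> a = 0"
proof
  assume "\<phi> a = 0"
  hence "\<phi> (a * inverse a) = 0" by (simp add: \<phi>_mult)
  thus "a = 0" using \<phi>_one by (cases "a = 0") auto
qed (auto simp: \<phi>_zero)

lemma inj_\<phi>: "inj \<phi>"
  by (rule injI) (metis \<phi>_diff \<phi>_eq_0_iff right_minus_eq)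

definition ev :: "'f \<Rightarrow> 'k poly \<Rightarrow> 'f" where
  "ev u g = poly (map_poly \<phi> g) u"

lemma map_poly_add: "map_poly \<phi> (g + h) = map_poly \<phi> g + map_poly \<phi> h"
  by (intro poly_eqI) (simp add: coeff_map_poly \<phi>_zero \<phi>_add)

lemma ev_pCons: "ev u (pCons a g) = \<phi> a + u * ev u g"
  by (simp add: ev_def map_poly_pCons \<phi>_zero)

lemma ev_zero: "ev u 0 = 0"
  by (simp add: ev_def)

lemma ev_const: "ev u [:a:] = \<phi> a"
  by (simp add: ev_pCons ev_zero)

lemma ev_one: "ev u 1 = 1"
  by (simp add: one_pCons ev_const \<phi>_one)

lemma ev_add: "ev u (g + h) = ev u g + ev u h"
  by (simp add: ev_def map_poly_add)

lemma ev_smult: "ev u (smult a g) = \<phi> a * ev u g"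
  by (simp add: ev_def map_poly_smult \<phi>_zero \<phi>_mult)

lemma ev_mult: "ev u (g * h) = ev u g * ev u h"
  by (induction g) (auto simp: ev_zero ev_pCons ev_add ev_smult algebra_simps)

lemma ev_uminus: "ev u (- g) = - ev u g"
  using ev_smult[of u "-1" g] by (simp add: \<phi>_uminus \<phi>_one)

lemma ev_diff: "ev u (g - h) = ev u g - ev u h"
  using ev_add[of u g "- h"] by (simp add: ev_uminus)

lemma ev_power: "ev u (g ^ n) = ev u g ^ n"
  by (induction n) (auto simp: ev_one ev_mult)

lemma ev_sum: "ev u (sum g I) = (\<Sum>i\<in>I. ev u (g i))"
  by (induction I rule: infinite_finite_induct) (auto simp: ev_zero ev_add)

lemma ev_monom: "ev u (monom a n) = \<phi> a * u ^ n"
  by (simp add: ev_def map_poly_monom \<phi>_zero poly_monom)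

lemma ev_X: "ev u [:0, 1:] = u"
  by (simp add: ev_pCons ev_zero \<phi>_zero \<phi>_one)

lemma subring_ev: "subring (range (ev u))"
  unfolding subring_def by (auto simp flip: ev_one[of u] ev_diff ev_mult)

lemma ev_inverse:
  assumes "x \<noteq> 0" shows "ev (inverse x) (reflect_poly g) * x ^ degree g = ev x g"
proof -
  have "reflect_poly (map_poly \<phi> g) = map_poly \<phi> (reflect_poly g)"
    by (intro poly_eqI)
      (simp add: coeff_reflect_poly coeff_map_poly \<phi>_zero degree_map_poly \<phi>_eq_0_iff)
  hence "ev (inverse x) (reflect_poly g) = inverse x ^ degree g * ev x g"
    using poly_reflect_poly_nz[of "inverse x" "map_poly \<phi> g"] assms
    by (simp add: ev_def degree_map_poly \<phi>_eq_0_iff)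
  thus ?thesis using assms by (simp add: field_simps)
qed

lemma transcendental_ev: "transcendental_over \<phi> u \<longleftrightarrow> (\<forall>g. ev u g = 0 \<longrightarrow> g = 0)"
  by (auto simp: transcendental_over_def ev_def)

lemma transcendental_nonzero: "transcendental_over \<phi> u \<Longrightarrow> u \<noteq> 0"
  using ev_X[of u] by (auto simp: transcendental_ev)

lemma transcendental_inverse:
  assumes "transcendental_over \<phi> x" shows "transcendental_over \<phi> (inverse x)"
  unfolding transcendental_ev
proof (intro allI impI)
  fix g assume "ev (inverse x) g = 0"
  moreover have "x \<noteq> 0" using assms by (rule transcendental_nonzero)
  ultimately have "ev x (reflect_poly g) = 0" using ev_inverse[of "inverse x" g] by auto
  thus "g = 0" using assms by (auto simp: transcendental_ev)
qed

text \<open>The coefficients range over \<open>K[u]\<close> instead of \<open>K(u)\<close>, which only means that denominators are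
cleared. The bound \<open>N\<close> is the same for all \<open>f\<close>; it bounds the denominators of the values of a
valuation in terms of its values on \<open>K(u)\<close>, and thus makes the value group cyclic.\<close>

definition bounded_degree_over :: "'f \<Rightarrow> nat \<Rightarrow> bool" where
  "bounded_degree_over u N \<longleftrightarrow>
     (\<forall>f. \<exists>c. (\<exists>j\<le>N. c j \<noteq> 0) \<and> (\<Sum>j\<le>N. ev u (c j) * f ^ j) = 0)"

lemma bounded_degree_overE:
  assumes "bounded_degree_over u N"
  obtains c where "\<exists>j\<le>N. c j \<noteq> 0" "(\<Sum>j\<le>N. ev u (c j) * f ^ j) = 0"
  using assms unfolding bounded_degree_over_def by metis

lemma bounded_degree_over_inverse:
  assumes x: "x \<noteq> 0" and bd: "bounded_degree_over x N"
  shows "bounded_degree_over (inverse x) N"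
  unfolding bounded_degree_over_def
proof
  fix f
  obtain c where c: "\<exists>j\<le>N. c j \<noteq> 0" "(\<Sum>j\<le>N. ev x (c j) * f ^ j) = 0"
    using bounded_degree_overE[OF bd] by metis
  \<comment> \<open>Any common bound of the degrees serves; the relation is multiplied by \<open>inverse x ^ D\<close>.\<close>
  define D where "D = (\<Sum>j\<le>N. degree (c j))"
  define c' where "c' = (\<lambda>j. monom 1 (D - degree (c j)) * reflect_poly (c j))"
  have "ev (inverse x) (c' j) = inverse x ^ D * ev x (c j)" if "j \<le> N" for j
  proof -
    have "degree (c j) \<le> D" unfolding D_def using that by (intro member_le_sum) auto
    hence "inverse x ^ D = inverse x ^ (D - degree (c j)) * inverse x ^ degree (c j)"
      by (simp flip: power_add)
    moreover have "ev (inverse x) (reflect_poly (c j)) = inverse x ^ degree (c j) * ev x (c j)"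
      using ev_inverse[OF x, of "c j"] x by (simp add: field_simps)
    ultimately show ?thesis by (simp add: c'_def ev_mult ev_monom \<phi>_one)
  qed
  hence "(\<Sum>j\<le>N. ev (inverse x) (c' j) * f ^ j) = inverse x ^ D * (\<Sum>j\<le>N. ev x (c j) * f ^ j)"
    by (simp add: sum_distrib_left mult_ac)
  moreover have "\<exists>j\<le>N. c' j \<noteq> 0" using c(1) by (auto simp: c'_def)
  ultimately show "\<exists>c. (\<exists>j\<le>N. c j \<noteq> 0) \<and> (\<Sum>j\<le>N. ev (inverse x) (c j) * f ^ j) = 0"
    using c(2) by (intro exI[of _ c']) simp
qed

lemma constants_units:
  assumes "range \<phi> \<subseteq> R" "c \<noteq> 0" shows "\<phi> c \<in> units R"
proof -
  have "inverse (\<phi> c) \<in> R" using assms \<phi>_inverse[of c] by (metis range_subsetD)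
  thus ?thesis using assms by (auto simp: units_def \<phi>_eq_0_iff)
qed

lemma ev_in_subring:
  assumes R: "subring R" "range \<phi> \<subseteq> R" "u \<in> R" shows "ev u g \<in> R"
  using R by (induction g) (auto simp: ev_zero ev_pCons intro!: subring_closed)

text \<open>The non-units of \<open>R\<close> form an ideal, so the polynomials whose value at \<open>u\<close> is a non-unit
form an ideal as well; an element of least degree generates it by division with remainder.\<close>

lemma centre_generator:
  assumes R: "valuation_ring R" "range \<phi> \<subseteq> R" "u \<in> R"
    and g0: "g\<^sub>0 \<noteq> 0" "ev u g\<^sub>0 \<notin> units R"
  obtains \<pi> where "\<pi> \<noteq> 0" "degree \<pi> > 0" "\<And>g. ev u g \<in> units R \<longleftrightarrow> \<not> \<pi> dvd g"
proof -
  note S = valuation_ring_subring[OF R(1)]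
  note evR = ev_in_subring[OF S R(2,3)]
  obtain \<pi> where \<pi>: "\<pi> \<noteq> 0" "ev u \<pi> \<notin> units R"
    and least: "\<And>g. g \<noteq> 0 \<Longrightarrow> ev u g \<notin> units R \<Longrightarrow> degree \<pi> \<le> degree g"
    using ex_has_least_nat[of "\<lambda>g. g \<noteq> 0 \<and> ev u g \<notin> units R" g\<^sub>0 degree] g0 by blast
  have mult: "ev u (\<pi> * h) \<notin> units R" for h
    using units_factor[OF S evR evR] \<pi>(2) by (auto simp: ev_mult)
  have dvd: "\<pi> dvd g" if "ev u g \<notin> units R" for g
  proof (rule ccontr)
    assume nd: "\<not> \<pi> dvd g"
    have "ev u (\<pi> * - (g div \<pi>)) \<in> R - units R" using mult evR by blast
    moreover have "ev u g \<in> R - units R" using that evR by blast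
    ultimately have "ev u (g + \<pi> * - (g div \<pi>)) \<notin> units R"
      using nonunits_add[OF R(1)] unfolding ev_add by (metis DiffD2 add.commute)
    moreover have "g + \<pi> * - (g div \<pi>) = g mod \<pi>" by (simp add: minus_mult_div_eq_mod)
    moreover have "g mod \<pi> \<noteq> 0" using nd by (simp add: dvd_eq_mod_eq_0)
    ultimately have "degree \<pi> \<le> degree (g mod \<pi>)" using least by metis
    thus False using degree_mod_less[OF \<pi>(1), of g] \<open>g mod \<pi> \<noteq> 0\<close> by auto
  qed
  have "degree \<pi> > 0"
  proof (rule ccontr)
    assume "\<not> ?thesis"
    then obtain a where "\<pi> = [:a:]" by (auto elim: degree_eq_zeroE)
    thus False using \<pi> constants_units[OF R(2)] by (auto simp: ev_const)
  qed
  thus thesis using that[of \<pi>] \<pi>(1) dvd mult by (metis dvdE)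
qed

lemma split_off_power:
  fixes \<pi> :: "'k poly"
  assumes "degree \<pi> > 0" "g \<noteq> 0"
  shows "\<exists>k h. g = \<pi> ^ k * h \<and> \<not> \<pi> dvd h"
  using assms(2)
proof (induction "degree g" arbitrary: g rule: less_induct)
  case less
  show ?case
  proof (cases "\<pi> dvd g")
    case True
    then obtain g' where g': "g = \<pi> * g'" by auto
    hence "g' \<noteq> 0" "degree g' < degree g"
      using less.prems assms(1) by (auto simp: degree_mult_eq)
    then obtain k h where "g' = \<pi> ^ k * h \<and> \<not> \<pi> dvd h" using less.hyps by blast
    thus ?thesis using g' by (intro exI[of _ "Suc k"] exI[of _ h]) (auto simp: mult.assoc)
  next
    case False
    thus ?thesis by (intro exI[of _ 0] exI[of _ g]) auto
  qed
qed

text \<open>After division by a power of \<open>f\<close> the relation has a non-zero constant term, and all the other terms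
are multiples of \<open>f\<close>. For a non-unit \<open>f\<close> of a valuation ring this yields a polynomial in \<open>u\<close> that
is a non-unit; in general it expresses \<open>inverse f\<close> by powers of \<open>f\<close>.\<close>

lemma algebraic_divides_constant_term:
  assumes "\<exists>j\<le>N. c j \<noteq> 0" "(\<Sum>j\<le>N. ev u (c j) * f ^ j) = 0" "f \<noteq> 0"
  shows "\<exists>a d M. a \<noteq> 0 \<and> ev u a = f * (\<Sum>i<M. ev u (d i) * f ^ i)"
  using assms(1,2)
proof (induction N arbitrary: c)
  case 0
  thus ?case by (intro exI[of _ "c 0"] exI[of _ c] exI[of _ 0]) auto
next
  case (Suc N)
  have split: "(\<Sum>j\<le>Suc N. ev u (c j) * f ^ j)
      = ev u (c 0) + f * (\<Sum>j\<le>N. ev u (c (Suc j)) * f ^ j)"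
    by (simp add: sum.atMost_Suc_shift sum_distrib_left mult_ac del: sum.atMost_Suc)
  show ?case
  proof (cases "c 0 = 0")
    case True
    hence "\<exists>j\<le>N. c (Suc j) \<noteq> 0" using Suc.prems(1) by (metis Suc_le_mono not0_implies_Suc)
    moreover have "(\<Sum>j\<le>N. ev u (c (Suc j)) * f ^ j) = 0"
      using Suc.prems(2) split True assms(3) by (simp add: ev_zero)
    ultimately show ?thesis by (rule Suc.IH)
  next
    case False
    have "ev u (c 0) = f * (\<Sum>i<Suc N. ev u (- c (Suc i)) * f ^ i)"
      using Suc.prems(2) unfolding split
      by (simp only: lessThan_Suc_atMost ev_uminus mult_minus_left sum_negf mult_minus_right
          eq_neg_iff_add_eq_0)
    thus ?thesis
      using False by (intro exI[of _ "c 0"] exI[of _ "\<lambda>i. - c (Suc i)"] exI[of _ "Suc N"]) simp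
  qed
qed

text \<open>Every valuation ring that contains the constants is discrete. Let \<open>u\<close> be that one of \<open>x\<close>
  and \<open>1/x\<close> which lies in the ring. On \<open>K(u)\<close> the value group is generated by the value of a prime
  polynomial \<open>\<pi>(u)\<close>. A function \<open>f\<close> satisfies an equation of degree at most \<open>N\<close> over \<open>K[u]\<close>, and
  two of its terms have the same value; so some \<open>f ^ d\<close> with \<open>1 \<le> d \<le> N\<close> has the value of a
  power of \<open>\<pi>(u)\<close>.\<close>

theorem place_of_valuation_ring:
  assumes tr: "transcendental_over \<phi> x" and bd: "bounded_degree_over x N"
    and R: "valuation_ring R" "range \<phi> \<subseteq> R" "R \<noteq> UNIV"
  obtains v where "is_place \<phi> v" "\<And>f. f \<noteq> 0 \<Longrightarrow> v f \<ge> 0 \<longleftrightarrow> f \<in> R"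
proof -
  note S = valuation_ring_subring[OF R(1)]
  have "\<exists>u. u \<in> R \<and> transcendental_over \<phi> u \<and> bounded_degree_over u N"
    using tr bd R(1) transcendental_inverse bounded_degree_over_inverse transcendental_nonzero
    by (metis valuation_ring_def)
  then obtain u where u: "u \<in> R" "transcendental_over \<phi> u" "bounded_degree_over u N" by blast
  note evR = ev_in_subring[OF S R(2) u(1)]
  have ev0: "ev u g \<noteq> 0" if "g \<noteq> 0" for g using u(2) that by (auto simp: transcendental_ev)
  obtain f\<^sub>0 where f0: "f\<^sub>0 \<notin> R" using R(3) by blast
  define z where "z = inverse f\<^sub>0"
  have z: "z \<in> R" "z \<notin> units R" using f0 R(1) by (auto simp: z_def valuation_ring_def units_def)
  have z0: "z \<noteq> 0" using f0 subring_zero[OF S] by (auto simp: z_def)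
  obtain c where c: "\<exists>j\<le>N. c j \<noteq> 0" "(\<Sum>j\<le>N. ev u (c j) * z ^ j) = 0"
    using bounded_degree_overE[OF u(3)] by metis
  from algebraic_divides_constant_term[OF this z0]
  obtain a d M where a: "a \<noteq> 0" "ev u a = z * (\<Sum>i<M. ev u (d i) * z ^ i)" by blast
  have "(\<Sum>i<M. ev u (d i) * z ^ i) \<in> R"
    using z(1) evR S by (intro subring_sum subring_mult subring_power)
  hence "ev u a \<notin> units R" using units_factor[OF S z(1)] z(2) a(2) by metis
  then obtain \<pi> where \<pi>: "\<pi> \<noteq> 0" "degree \<pi> > 0" "\<And>g. ev u g \<in> units R \<longleftrightarrow> \<not> \<pi> dvd g"
    using centre_generator[OF R(1,2) u(1) a(1)] by blast
  define \<zeta> where "\<zeta> = ev u \<pi>"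
  have \<zeta>: "\<zeta> \<in> R" "\<zeta> \<noteq> 0" "\<zeta> \<notin> units R" using evR ev0[OF \<pi>(1)] \<pi>(3)[of \<pi>] by (auto simp: \<zeta>_def)
  have base: "\<exists>k::int. ev u g / \<zeta> powi k \<in> units R" if g: "g \<noteq> 0" for g
  proof -
    obtain k h where "g = \<pi> ^ k * h" "\<not> \<pi> dvd h" using split_off_power[OF \<pi>(2) g] by blast
    hence "ev u g / \<zeta> powi int k \<in> units R"
      using \<pi>(3)[of h] \<zeta>(2) by (simp add: ev_mult ev_power \<zeta>_def)
    thus ?thesis by blast
  qed
  have power_value: "\<exists>k::int. f ^ fact N / \<zeta> powi k \<in> units R" if f: "f \<noteq> 0" for f
  proof -
    obtain c where c: "\<exists>j\<le>N. c j \<noteq> 0" "(\<Sum>j\<le>N. ev u (c j) * f ^ j) = 0"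
      using bounded_degree_overE[OF u(3)] by metis
    define t where "t = (\<lambda>j. ev u (c j) * f ^ j)"
    obtain i\<^sub>0 where "i\<^sub>0 \<in> {..N}" "t i\<^sub>0 \<noteq> 0" using c(1) ev0 f by (auto simp: t_def)
    moreover have "(\<Sum>j\<le>N. t j) = 0" using c(2) by (simp add: t_def)
    ultimately obtain i' j' where "i' \<in> {..N}" "j' \<in> {..N}" "i' \<noteq> j'" "t i' / t j' \<in> units R"
      using zero_sum_two_minimal_terms[OF R(1) finite_atMost, of i\<^sub>0 N t] by metis
    hence ij': "i' \<le> N" "j' \<le> N" "i' \<noteq> j'" "t i' / t j' \<in> units R" by simp_all
    obtain i j where ij: "i \<le> N" "j < i" "t i / t j \<in> units R"
    proof (cases "j' < i'")
      case True thus thesis using that ij' by blast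
    next
      case False
      hence "i' < j'" using ij'(3) by simp
      moreover have "t j' / t i' \<in> units R" using units_inverse[OF ij'(4)] by simp
      ultimately show thesis using that ij'(2) by blast
    qed
    have nz: "c i \<noteq> 0" "c j \<noteq> 0" using ij(3) by (auto simp: t_def units_def ev_zero)
    obtain a b :: int where ab: "ev u (c i) / \<zeta> powi a \<in> units R" "ev u (c j) / \<zeta> powi b \<in> units R"
      using base nz by blast
    have "f ^ (i - j) / \<zeta> powi (b - a)
        = t i / t j * (ev u (c j) / \<zeta> powi b) / (ev u (c i) / \<zeta> powi a)"
      using f \<zeta>(2) ev0[OF nz(1)] ev0[OF nz(2)] ij(2)
      by (simp add: t_def power_int_diff power_diff field_simps)
    also have "\<dots> \<in> units R" using units_mult[OF S ij(3) ab(2)] units_divide[OF S _ ab(1)] by blast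
    finally have unit: "f ^ (i - j) / \<zeta> powi (b - a) \<in> units R" .
    \<comment> \<open>The exponent depends on \<open>f\<close>; the factorial is a common multiple of the possible ones.\<close>
    have "(i - j) dvd fact N" using ij by (intro dvd_fact) auto
    then obtain e where e: "fact N = (i - j) * e" by blast
    have "f ^ fact N / \<zeta> powi ((b - a) * int e) = (f ^ (i - j) / \<zeta> powi (b - a)) ^ e"
      by (simp add: e power_mult power_divide power_int_mult)
    thus ?thesis using units_power[OF S unit] by metis
  qed
  have "inverse \<zeta> \<notin> R" using \<zeta> by (auto simp: units_def)
  from discrete_valuation_of_valuation_ring[OF R(1) \<zeta>(1,2) this fact_gt_zero power_value]
  obtain v where v: "discrete_valuation v" "\<And>f. f \<noteq> 0 \<Longrightarrow> v f \<ge> 0 \<longleftrightarrow> f \<in> R"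
    by metis
  have "v (\<phi> c) = 0" if "c \<noteq> 0" for c
  proof -
    have U: "\<phi> c \<in> units R" using constants_units[OF R(2) that] .
    hence "v (\<phi> c) \<ge> 0" "v (inverse (\<phi> c)) \<ge> 0" using v(2) by (auto simp: units_def)
    moreover have mult: "v (a * b) = v a + v b" if "a \<noteq> 0" "b \<noteq> 0" for a b
      using v(1) that by (simp add: discrete_valuation_def)
    have "v (\<phi> c) + v (inverse (\<phi> c)) = v 1" "v 1 = 0"
      using mult[of "\<phi> c" "inverse (\<phi> c)"] mult[of 1 1] U by (auto simp: units_def)
    ultimately show ?thesis by simp
  qed
  hence "is_place \<phi> v" using v(1) by (simp add: is_place_def discrete_valuation_def)
  thus thesis using that v(2) by blast
qed

end

section \<open>Linear dependence, division and interpolation\<close>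

text \<open>One coordinate is eliminated without fractions, by cross multiplication with a pivot row, so the
coefficients stay in the domain.\<close>

lemma linear_dependence:
  fixes M :: "'i \<Rightarrow> 'j \<Rightarrow> 'a::idom"
  assumes "finite J" "finite I" "card J < card I"
  shows "\<exists>c. (\<exists>i\<in>I. c i \<noteq> 0) \<and> (\<forall>j\<in>J. (\<Sum>i\<in>I. c i * M i j) = 0)"
  using assms
proof (induction J arbitrary: I M rule: finite_induct)
  case empty
  hence "I \<noteq> {}" by auto
  thus ?case by (intro exI[of _ "\<lambda>_. 1"]) auto
next
  case (insert k J)
  show ?case
  proof (cases "\<forall>i\<in>I. M i k = 0")
    case True
    obtain c where "\<exists>i\<in>I. c i \<noteq> 0" "\<forall>j\<in>J. (\<Sum>i\<in>I. c i * M i j) = 0"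
      using insert.IH[of I M] insert.prems insert.hyps by auto
    thus ?thesis using True by (intro exI[of _ c]) auto
  next
    case False
    then obtain p where p: "p \<in> I" "M p k \<noteq> 0" by blast
    define I' where "I' = I - {p}"
    have I': "finite I'" "card J < card I'" "I = insert p I'" "p \<notin> I'"
      using insert.prems insert.hyps p(1) by (auto simp: I'_def)
    have "\<exists>c. (\<exists>i\<in>I'. c i \<noteq> 0) \<and>
        (\<forall>j\<in>J. (\<Sum>i\<in>I'. c i * (M p k * M i j - M i k * M p j)) = 0)"
      by (rule insert.IH) (use I' in auto)
    then obtain c where c: "\<exists>i\<in>I'. c i \<noteq> 0"
      "\<forall>j\<in>J. (\<Sum>i\<in>I'. c i * (M p k * M i j - M i k * M p j)) = 0"
      by blast
    define c' where "c' = (\<lambda>i. if i = p then - (\<Sum>i\<in>I'. c i * M i k) else c i * M p k)"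
    have "(\<Sum>i\<in>I. c' i * M i j) = (\<Sum>i\<in>I'. c i * (M p k * M i j - M i k * M p j))" for j
    proof -
      have "(\<Sum>i\<in>I'. c' i * M i j) = (\<Sum>i\<in>I'. c i * M p k * M i j)"
        using I'(4) by (intro sum.cong) (auto simp: c'_def)
      thus ?thesis using I'(1,3,4)
        by (simp add: c'_def sum_subtractf sum_distrib_left algebra_simps)
    qed
    moreover have "(\<Sum>i\<in>I'. c i * (M p k * M i k - M i k * M p k)) = 0"
      by (simp add: mult.commute)
    moreover have "\<exists>i\<in>I. c' i \<noteq> 0" using c(1) p(2) I'(3,4) by (auto simp: c'_def)
    ultimately show ?thesis using c(2) by (intro exI[of _ c']) auto
  qed
qed

lemma monic_division:
  fixes D :: "'f::field poly"
  assumes A: "subring A" and D: "D \<in> polys_over A" "lead_coeff D = 1" "degree D > 0"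
    and "H \<in> polys_over A"
  shows "\<exists>Q r. Q \<in> polys_over A \<and> r \<in> polys_over A \<and> H = Q * D + r \<and> degree r < degree D"
  using assms(5)
proof (induction "degree H" arbitrary: H rule: less_induct)
  case less
  show ?case
  proof (cases "degree H < degree D")
    case True
    thus ?thesis using less.prems subring_zero[OF A]
      by (intro exI[of _ 0] exI[of _ H]) (auto simp: polys_over_def)
  next
    case False
    define E where "E = monom (lead_coeff H) (degree H - degree D)"
    have E: "E \<in> polys_over A" using less.prems A
      unfolding E_def by (intro polys_over_monom) (auto simp: polys_over_def)
    define H' where "H' = H - E * D"
    have H': "H' \<in> polys_over A" unfolding H'_def
      using A less.prems E D(1) by (intro polys_over_diff polys_over_mult)
    have "degree (E * D) \<le> degree H"
      unfolding E_def using False degree_mult_le[of "monom (lead_coeff H) (degree H - degree D)" D]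
        degree_monom_le[of "lead_coeff H" "degree H - degree D"] by linarith
    hence "degree H' \<le> degree H" unfolding H'_def by (intro degree_diff_le) auto
    moreover have "coeff H' (degree H) = 0"
      using False D(2) by (simp add: H'_def E_def coeff_monom_mult)
    moreover have "degree H > 0" using False D(3) by simp
    ultimately have "degree H' < degree H"
      by (metis degree_0 le_neq_implies_less leading_coeff_0_iff)
    then obtain Q r where "Q \<in> polys_over A" "r \<in> polys_over A" "H' = Q * D + r" "degree r < degree D"
      using less.hyps[OF _ H'] by blast
    thus ?thesis using E A
      by (intro exI[of _ "Q + E"] exI[of _ r])
        (auto simp: H'_def algebra_simps intro: polys_over_add)
  qed
qed

text \<open>Newton interpolation: splitting off the value at one point and dividing by the linear factor
uses no other denominators than the differences of the points.\<close>

lemma coeffs_from_values: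
  fixes G :: "'f::field poly"
  assumes S: "subring S" and "finite T" "T \<subseteq> S"
    and "\<And>s t. s \<in> T \<Longrightarrow> t \<in> T \<Longrightarrow> s \<noteq> t \<Longrightarrow> inverse (s - t) \<in> S"
    and "\<And>t. t \<in> T \<Longrightarrow> poly G t \<in> S" and "G = 0 \<or> degree G < card T"
  shows "G \<in> polys_over S"
  using assms(2-)
proof (induction T arbitrary: G rule: finite_induct)
  case empty
  thus ?case using subring_zero[OF S] by (auto simp: polys_over_def)
next
  case (insert s T)
  obtain G' where G': "G - [:poly G s:] = [:- s, 1:] * G'"
    by (metis dvdE poly_eq_0_iff_dvd poly_diff poly_pCons poly_0 mult_zero_right add.right_neutral
        diff_self)
  have eval: "poly G t - poly G s = (t - s) * poly G' t" for t
    using arg_cong[OF G', of "\<lambda>g. poly g t"] by (simp add: algebra_simps)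
  have "G' \<in> polys_over S"
  proof (rule insert.IH)
    fix t assume t: "t \<in> T"
    hence ne: "t \<noteq> s" using insert.hyps by auto
    have "poly G' t = inverse (t - s) * (poly G t - poly G s)" using eval[of t] ne by simp
    also have "\<dots> \<in> S" using insert.prems t ne S by (intro subring_mult subring_diff) auto
    finally show "poly G' t \<in> S" .
  next
    show "G' = 0 \<or> degree G' < card T"
    proof (cases "G' = 0")
      case False
      have "Suc (degree G') = degree (G - [:poly G s:])"
        unfolding G' using False by (subst degree_mult_eq) auto
      also have "\<dots> \<le> degree G" by (intro degree_diff_le) auto
      finally show ?thesis using insert.prems(4) insert.hyps by auto
    qed auto
  qed (use insert.prems in auto)
  moreover have "[:- s, 1:] \<in> polys_over S" "[:poly G s:] \<in> polys_over S"
    using insert.prems S subring_uminus[OF S, of s] subring_one[OF S] subring_zero[OF S]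
    by (auto simp: polys_over_def coeff_pCons split: nat.splits)
  moreover have "G = [:- s, 1:] * G' + [:poly G s:]" using G' by (simp add: algebra_simps)
  ultimately show ?case using polys_over_add[OF S polys_over_mult[OF S]] by metis
qed

section \<open>Values at a place\<close>

context constant_field begin

definition integers_of :: "('f \<Rightarrow> int) \<Rightarrow> 'f set" where
  "integers_of v = {f. f = 0 \<or> v f \<ge> 0}"

context
  fixes v assumes v: "is_place \<phi> v"
begin

lemma place_mult: "a \<noteq> 0 \<Longrightarrow> b \<noteq> 0 \<Longrightarrow> v (a * b) = v a + v b"
  and place_add: "a \<noteq> 0 \<Longrightarrow> b \<noteq> 0 \<Longrightarrow> a + b \<noteq> 0 \<Longrightarrow> min (v a) (v b) \<le> v (a + b)"
  and place_const: "a' \<noteq> 0 \<Longrightarrow> v (\<phi> a') = 0"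
  and place_zero: "v 0 = 0"
  using v by (auto simp: is_place_def)

lemma place_surj: "\<exists>f. f \<noteq> 0 \<and> v f = k"
proof -
  have "k \<in> v ` (- {0})" using v by (simp add: is_place_def)
  thus ?thesis by auto
qed

lemma place_one: "v 1 = 0"
  using place_mult[of 1 1] by simp

lemma place_uminus: "v (- a) = v a"
  using place_mult[of "-1" a] place_const[of "-1"]
  by (cases "a = 0") (auto simp: \<phi>_uminus \<phi>_one)

lemma place_power: "a \<noteq> 0 \<Longrightarrow> v (a ^ n) = int n * v a"
  by (induction n) (auto simp: place_one place_mult algebra_simps)

lemma place_inverse: "a \<noteq> 0 \<Longrightarrow> v (inverse a) = - v a"
  using place_mult[of a "inverse a"] place_one by simp

lemma place_divide: "a \<noteq> 0 \<Longrightarrow> b \<noteq> 0 \<Longrightarrow> v (a / b) = v a - v b"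
  by (simp add: divide_inverse place_mult place_inverse)

lemma subring_integers: "subring (integers_of v)"
  unfolding subring_def
proof (intro conjI ballI)
  fix a b assume ab: "a \<in> integers_of v" "b \<in> integers_of v"
  show "a - b \<in> integers_of v"
    using ab place_add[of a "- b"]
    by (cases "a = 0"; cases "b = 0"; cases "a = b") (auto simp: integers_of_def place_uminus)
  show "a * b \<in> integers_of v" using ab
    by (cases "a = 0"; cases "b = 0") (auto simp: integers_of_def place_mult)
qed (simp add: integers_of_def place_one)

lemma constants_integers: "range \<phi> \<subseteq> integers_of v"
  by (auto simp: integers_of_def) (metis \<phi>_zero order_refl place_const)

lemma place_add_strict:
  assumes "a \<noteq> 0" "b = 0 \<or> v a < v b"
  shows "a + b \<noteq> 0 \<and> v (a + b) = v a"
proof (cases "b = 0")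
  case False
  hence lt: "v a < v b" using assms(2) by simp
  have ne: "a + b \<noteq> 0"
  proof
    assume "a + b = 0"
    hence "v a = v b" using place_uminus[of b] by (simp add: add_eq_0_iff2)
    thus False using lt by simp
  qed
  have "v a \<le> v (a + b)" using place_add[OF assms(1) False ne] lt by simp
  moreover have "min (v (a + b)) (v b) \<le> v a"
    using place_add[of "a + b" "- b"] ne False assms(1) by (simp add: place_uminus)
  ultimately show ?thesis using lt ne by auto
qed (use assms in auto)

lemma place_dominant_term:
  assumes "finite I" "k \<in> I" "t k \<noteq> 0"
    and "\<And>i. i \<in> I \<Longrightarrow> i \<noteq> k \<Longrightarrow> t i = 0 \<or> v (t k) < v (t i)"
  shows "sum t I \<noteq> 0 \<and> v (sum t I) = v (t k)"
proof -
  have "sum t K = 0 \<or> v (t k) < v (sum t K)" if "K \<subseteq> I - {k}" for K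
    using finite_subset[OF that] assms(1) that
  proof (induction K rule: infinite_finite_induct)
    case (insert j K)
    have "t j = 0 \<or> v (t k) < v (t j)" using assms(4) insert.prems by auto
    moreover have "sum t K = 0 \<or> v (t k) < v (sum t K)" using insert by auto
    ultimately show ?case
      using insert.hyps place_add[of "t j" "sum t K"] by (cases "t j + sum t K = 0") fastforce+
  qed auto
  from place_add_strict[OF assms(3) this[of "I - {k}"]] show ?thesis
    using assms(1,2) by (simp add: sum.remove)
qed

text \<open>At a pole of \<open>u\<close> the leading term of a polynomial in \<open>u\<close> dominates.\<close>

lemma place_ev_pole:
  assumes u: "v u < 0" and g: "g \<noteq> 0"
  shows "ev u g \<noteq> 0 \<and> v (ev u g) = int (degree g) * v u"
proof -
  have u0: "u \<noteq> 0" using u place_zero by auto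
  have ev: "ev u g = (\<Sum>i\<le>degree g. \<phi> (coeff g i) * u ^ i)"
    by (simp add: ev_def poly_altdef degree_map_poly \<phi>_eq_0_iff coeff_map_poly)
  have val: "v (\<phi> (coeff g i) * u ^ i) = int i * v u" if "coeff g i \<noteq> 0" for i
    using that u0 by (simp add: place_mult place_power place_const \<phi>_eq_0_iff)
  have "sum (\<lambda>i. \<phi> (coeff g i) * u ^ i) {..degree g} \<noteq> 0
      \<and> v (sum (\<lambda>i. \<phi> (coeff g i) * u ^ i) {..degree g})
        = v (\<phi> (coeff g (degree g)) * u ^ degree g)"
  proof (rule place_dominant_term)
    fix i assume "i \<in> {..degree g}" "i \<noteq> degree g"
    hence "int (degree g) * v u < int i * v u" using u by (simp add: mult_less_cancel_right)
    thus "\<phi> (coeff g i) * u ^ i = 0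
        \<or> v (\<phi> (coeff g (degree g)) * u ^ degree g) < v (\<phi> (coeff g i) * u ^ i)"
      using val g by (cases "coeff g i = 0") auto
  qed (use g u0 in \<open>auto simp: \<phi>_eq_0_iff\<close>)
  thus ?thesis using val[of "degree g"] g by (simp add: ev)
qed

end

end

section \<open>Curves whose equation is invariant under translations\<close>

text \<open>The function field of a curve \<open>L(y) = c x ^ m\<close> with \<open>n = degree L\<close> prime to \<open>m\<close>. The set \<open>V\<close>
provides \<open>n\<close> solutions \<open>y + \<alpha>\<close> of the same equation, all inside the field, so the extension of
\<open>K(x)\<close> is Galois and the differences of the conjugates of \<open>y\<close> are constants.\<close>

locale translation_curve = constant_field \<phi>
  for \<phi> :: "'k::field \<Rightarrow> 'f::field" +
  fixes x y :: 'f and L :: "'k poly" and c :: 'k and m :: nat and V :: "'k set"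
  assumes transcendental: "transcendental_over \<phi> x"
    and generated: "is_subfield hull (range \<phi> \<union> {x, y}) = UNIV"
    and monic: "lead_coeff L = 1"
    and c: "c \<noteq> 0" and m: "m > 0" and coprime: "coprime (degree L) m"
    and V: "finite V" "card V = degree L" "0 \<in> V"
    and equation: "\<And>\<alpha>. \<alpha> \<in> V \<Longrightarrow> ev (y + \<phi> \<alpha>) L = \<phi> c * x ^ m"
begin

abbreviation (input) n :: nat where "n \<equiv> degree L"

abbreviation (input) Kx :: "'f set" where "Kx \<equiv> range (ev x)"

lemma n_pos: "n > 0"
  using V by (metis card_gt_0_iff empty_iff)

lemma x_nonzero: "x \<noteq> 0"
  using transcendental by (rule transcendental_nonzero)

lemma ev_x_eq_0_iff: "ev x g = 0 \<longleftrightarrow> g = 0"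
  using transcendental ev_zero by (auto simp: transcendental_ev)

lemma ev_x_inj: "ev x g = ev x h \<longleftrightarrow> g = h"
  using ev_x_eq_0_iff[of "g - h"] by (simp add: ev_diff)

lemma constants_Kx: "range \<phi> \<subseteq> Kx"
  by (auto simp flip: ev_const[of x])

definition \<Lambda> :: "'f poly" where
  "\<Lambda> = map_poly \<phi> L - [:\<phi> c * x ^ m:]"

lemma degree_\<Lambda>: "degree \<Lambda> = n"
  and lead_coeff_\<Lambda>: "lead_coeff \<Lambda> = 1"
proof -
  have d: "degree (map_poly \<phi> L) = n" by (simp add: degree_map_poly \<phi>_eq_0_iff)
  thus "degree \<Lambda> = n" unfolding \<Lambda>_def diff_conv_add_uminus
    using n_pos by (subst degree_add_eq_left) auto
  thus "lead_coeff \<Lambda> = 1"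
    using n_pos monic by (simp add: \<Lambda>_def coeff_map_poly \<phi>_one coeff_pCons split: nat.split)
qed

lemma \<Lambda>_over: "\<Lambda> \<in> polys_over Kx"
proof -
  have "\<phi> a \<in> Kx" for a using constants_Kx by auto
  moreover have "x \<in> Kx" by (metis ev_X rangeI)
  ultimately show ?thesis unfolding \<Lambda>_def
    by (intro polys_over_diff polys_over_const subring_ev subring_mult subring_power)
      (auto simp: polys_over_def coeff_map_poly)
qed

lemma \<Lambda>_root: "\<alpha> \<in> V \<Longrightarrow> poly \<Lambda> (y + \<phi> \<alpha>) = 0"
  using equation[of \<alpha>] by (simp add: \<Lambda>_def ev_def)

lemma reduce:
  assumes "H \<in> polys_over Kx"
  obtains Q r where "r \<in> polys_over Kx" "degree r < n" "H = Q * \<Lambda> + r"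
  using monic_division[OF subring_ev \<Lambda>_over lead_coeff_\<Lambda> _ assms] n_pos
  by (auto simp: degree_\<Lambda>)

text \<open>These are the polynomials in \<open>y\<close> over \<open>K(x)\<close>, with a common denominator. They turn out to be the
whole field; until then they serve as the carrier on which the algebraic relations are established.\<close>

definition fractions :: "'f set" where
  "fractions = {poly G y / ev x b | G b. G \<in> polys_over Kx \<and> b \<noteq> 0}"

lemma fractionsI: "G \<in> polys_over Kx \<Longrightarrow> b \<noteq> 0 \<Longrightarrow> f = poly G y / ev x b \<Longrightarrow> f \<in> fractions"
  by (auto simp: fractions_def)

lemma fractionsE:
  assumes "f \<in> fractions"
  obtains r b where "r \<in> polys_over Kx" "degree r < n" "b \<noteq> 0" "f = poly r y / ev x b"
proof -
  obtain G b where G: "G \<in> polys_over Kx" "b \<noteq> 0" "f = poly G y / ev x b"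
    using assms by (auto simp: fractions_def)
  obtain Q r where r: "r \<in> polys_over Kx" "degree r < n" "G = Q * \<Lambda> + r" using reduce[OF G(1)] .
  hence "poly G y = poly r y" using \<Lambda>_root[OF V(3)] by simp
  thus thesis using that G r by metis
qed

lemma Kx_fractions: "Kx \<subseteq> fractions"
proof
  fix a assume "a \<in> Kx"
  thus "a \<in> fractions"
    by (intro fractionsI[of "[:a:]" 1] polys_over_const subring_ev) (auto simp: ev_one)
qed

lemma subring_fractions: "subring fractions"
  unfolding subring_def
proof (intro conjI ballI)
  show "1 \<in> fractions" using Kx_fractions subring_one[OF subring_ev] by blast
next
  fix f g assume "f \<in> fractions" "g \<in> fractions"
  then obtain G b H d where *: "G \<in> polys_over Kx" "b \<noteq> 0" "f = poly G y / ev x b"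
    "H \<in> polys_over Kx" "d \<noteq> 0" "g = poly H y / ev x d"
    by (auto simp: fractions_def)
  have "smult (ev x d) G - smult (ev x b) H \<in> polys_over Kx"
    using * by (intro polys_over_diff polys_over_smult subring_ev) auto
  moreover have "f - g = poly (smult (ev x d) G - smult (ev x b) H) y / ev x (b * d)"
    using *(2,5) unfolding *(3,6) by (simp add: ev_mult ev_x_eq_0_iff field_simps)
  ultimately show "f - g \<in> fractions" using * by (intro fractionsI[of _ "b * d"]) auto
  have "G * H \<in> polys_over Kx" using * by (intro polys_over_mult subring_ev) auto
  thus "f * g \<in> fractions" using * by (intro fractionsI[of "G * H" "b * d"]) (auto simp: ev_mult)
qed

text \<open>The powers \<open>1, f, \<dots>, f ^ n\<close> are \<open>n + 1\<close> vectors in the span of the \<open>n\<close> elements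
\<open>1, y, \<dots>, y ^ (n - 1)\<close> over \<open>K(x)\<close>.\<close>

lemma fractions_algebraic:
  assumes f: "f \<in> fractions"
  shows "\<exists>a. (\<exists>j\<le>n. a j \<noteq> 0) \<and> (\<Sum>j\<le>n. ev x (a j) * f ^ j) = 0"
proof -
  have "\<exists>r b. r \<in> polys_over Kx \<and> degree r < n \<and> b \<noteq> 0 \<and> f ^ j = poly r y / ev x b" for j
    using fractionsE[OF subring_power[OF subring_fractions f]] by metis
  then obtain r b where r: "\<And>j. r j \<in> polys_over Kx" "\<And>j. degree (r j) < n"
    "\<And>j. b j \<noteq> 0" "\<And>j. f ^ j = poly (r j) y / ev x (b j)" by metis
  have "\<exists>g. coeff (r j) i = ev x g" for i j using r(1) by (fastforce simp: polys_over_def)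
  then obtain M where M: "\<And>i j. coeff (r j) i = ev x (M j i)" by metis
  obtain a where a: "\<exists>j\<in>{..n}. a j \<noteq> 0" "\<forall>i\<in>{..<n}. (\<Sum>j\<le>n. a j * M j i) = 0"
    using linear_dependence[of "{..<n}" "{..n}" M] by auto
  have "(\<Sum>j\<le>n. ev x (a j * b j) * f ^ j) = (\<Sum>j\<le>n. ev x (a j) * poly (r j) y)"
    by (intro sum.cong refl) (simp add: ev_mult r(3,4) ev_x_eq_0_iff)
  also have "\<dots> = (\<Sum>j\<le>n. \<Sum>i<n. ev x (a j) * (ev x (M j i) * y ^ i))"
  proof (intro sum.cong refl)
    fix j
    have "poly (r j) y = (\<Sum>i<n. coeff (r j) i * y ^ i)"
      unfolding poly_altdef using r(2)[of j] by (intro sum.mono_neutral_left) (auto simp: coeff_eq_0)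
    thus "ev x (a j) * poly (r j) y = (\<Sum>i<n. ev x (a j) * (ev x (M j i) * y ^ i))"
      by (simp add: M sum_distrib_left)
  qed
  also have "\<dots> = (\<Sum>i<n. ev x (\<Sum>j\<le>n. a j * M j i) * y ^ i)"
    by (subst sum.swap) (simp add: ev_sum ev_mult sum_distrib_right mult.assoc)
  also have "\<dots> = 0" using a(2) by (simp add: ev_zero)
  finally have "(\<Sum>j\<le>n. ev x (a j * b j) * f ^ j) = 0" .
  moreover have "\<exists>j\<le>n. a j * b j \<noteq> 0" using a(1) r(3) by auto
  ultimately show ?thesis by (intro exI[of _ "\<lambda>j. a j * b j"] conjI)
qed

lemma inverse_fractions:
  assumes f: "f \<in> fractions" shows "inverse f \<in> fractions"
proof (cases "f = 0")
  case False
  obtain a where "\<exists>j\<le>n. a j \<noteq> 0" "(\<Sum>j\<le>n. ev x (a j) * f ^ j) = 0"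
    using fractions_algebraic[OF f] by blast
  from algebraic_divides_constant_term[OF this False]
  obtain b d M where b: "b \<noteq> 0" "ev x b = f * (\<Sum>i<M. ev x (d i) * f ^ i)" by blast
  have "(\<Sum>i<M. ev x (d i) * f ^ i) \<in> fractions"
    using f Kx_fractions
    by (intro subring_sum subring_mult subring_power subring_fractions) auto
  moreover have "poly [:1:] y / ev x b \<in> fractions"
    using b(1) by (intro fractionsI[OF _ b(1) refl] polys_over_const subring_ev subring_one)
  ultimately have "poly [:1:] y / ev x b * (\<Sum>i<M. ev x (d i) * f ^ i) \<in> fractions"
    by (intro subring_mult subring_fractions)
  moreover have "inverse f = poly [:1:] y / ev x b * (\<Sum>i<M. ev x (d i) * f ^ i)"
    using b False ev_x_eq_0_iff[of b] by (simp add: field_simps)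
  ultimately show ?thesis by simp
qed (use f in simp)

lemma fractions_UNIV: "fractions = UNIV"
proof -
  have "x \<in> fractions" using Kx_fractions ev_X by (metis rangeI subsetD)
  moreover have "y \<in> fractions"
    using subring_ev[of x] by (intro fractionsI[of "[:0, 1:]" 1])
      (auto simp: ev_one polys_over_def coeff_pCons subring_zero subring_one split: nat.split)
  moreover have "is_subfield fractions"
    using subring_fractions inverse_fractions by (simp add: subring_def is_subfield_def)
  ultimately have "is_subfield hull (range \<phi> \<union> {x, y}) \<subseteq> fractions"
    using constants_Kx Kx_fractions by (intro hull_minimal) auto
  thus ?thesis using generated by auto
qed

lemma reduced_fraction:
  obtains r b where "r \<in> polys_over Kx" "degree r < n" "b \<noteq> 0" "f = poly r y / ev x b"
  using fractionsE[of f] fractions_UNIV by auto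

lemma bounded_degree: "bounded_degree_over x n"
  using fractions_algebraic fractions_UNIV by (auto simp: bounded_degree_over_def)

text \<open>All places that are needed arise in this way: from a ring of functions in which a given function \<open>z\<close>
is not invertible, so that \<open>z\<close> has a zero at some place.\<close>

lemma place_of_nonunit:
  assumes A: "subring A" "range \<phi> \<subseteq> A" "z \<in> A" "z \<noteq> 0" "\<forall>a\<in>A. z * a \<noteq> 1"
  shows "\<exists>R v. valuation_ring R \<and> A \<subseteq> R \<and> z \<notin> units R \<and> is_place \<phi> v \<and>
    (\<forall>f. f \<noteq> 0 \<longrightarrow> (v f \<ge> 0 \<longleftrightarrow> f \<in> R)) \<and> v z > 0"
proof -
  obtain R where R: "valuation_ring R" "A \<subseteq> R" "\<And>a. a \<in> R \<Longrightarrow> z * a \<noteq> 1"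
    using valuation_ring_exists[OF A(1,3)] A(5) by metis
  have iz: "inverse z \<notin> R" using R(3)[of "inverse z"] A(4) by auto
  hence "R \<noteq> UNIV" by auto
  with place_of_valuation_ring[OF transcendental bounded_degree R(1)] A(2) R(2)
  obtain v where v: "is_place \<phi> v" "\<And>f. f \<noteq> 0 \<Longrightarrow> v f \<ge> 0 \<longleftrightarrow> f \<in> R" by blast
  have "v z > 0" using v(2)[of "inverse z"] iz A(4) place_inverse[OF v(1), of z] by auto
  moreover have "z \<notin> units R" using iz by (simp add: units_def)
  ultimately show ?thesis using R(1,2) v by blast
qed

text \<open>In the polynomial ring \<open>K[1/x]\<close> the variable \<open>1/x\<close> is not invertible.\<close>

lemma pole_of_x_exists: "\<exists>v. is_place \<phi> v \<and> v x < 0"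
proof -
  define z where "z = inverse x"
  have z: "z \<noteq> 0" "z \<in> range (ev z)" "transcendental_over \<phi> z"
    using x_nonzero transcendental_inverse[OF transcendental] ev_X[of z] by (auto simp: z_def)
       (metis ev_X rangeI)
  have nonunit: "\<forall>a\<in>range (ev z). z * a \<noteq> 1"
  proof (intro ballI notI)
    fix a assume "a \<in> range (ev z)"
    assume eq: "z * a = 1"
    obtain g where "a = ev z g" using \<open>a \<in> range (ev z)\<close> by blast
    hence "ev z ([:0, 1:] * g - 1) = 0" using eq by (simp add: ev_diff ev_mult ev_X ev_one del: mult_pCons_left)
    hence "[:0, 1:] * g = 1" using z(3) by (auto simp: transcendental_ev simp del: mult_pCons_left)
    hence "coeff ([:0, 1:] * g) 0 = coeff 1 0" by (rule arg_cong)
    thus False by simp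
  qed
  have const: "range \<phi> \<subseteq> range (ev z)" by (auto simp flip: ev_const[of z])
  obtain v where "is_place \<phi> v" "v z > 0"
    using place_of_nonunit[OF subring_ev const z(2,1) nonunit] by blast
  moreover from this have "v x < 0" using place_inverse[of v x] x_nonzero by (simp add: z_def)
  ultimately show ?thesis by blast
qed

lemma finite_at_y:
  assumes v: "is_place \<phi> v" and x: "v x \<ge> 0"
  shows "v y \<ge> 0"
proof (rule ccontr)
  assume "\<not> ?thesis"
  hence neg: "v y < 0" by simp
  have "L \<noteq> 0" using n_pos by auto
  with place_ev_pole[OF v neg] have "v (ev y L) = int n * v y" by blast
  moreover have "ev y L = \<phi> c * x ^ m" using equation[OF V(3)] by simp
  moreover have "v (\<phi> c * x ^ m) = int m * v x"
    using c x_nonzero by (simp add: place_mult[OF v] place_power[OF v] place_const[OF v] \<phi>_eq_0_iff)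
  ultimately have "int m * v x = int n * v y" by simp
  moreover have "int m * v x \<ge> 0" using x by simp
  moreover have "int n * v y < 0" using neg n_pos by (simp add: mult_pos_neg)
  ultimately show False by simp
qed

text \<open>At a pole the two sides of \<open>L(y) = c x ^ m\<close> have the values \<open>n * v y\<close> and \<open>m * v x\<close>. Since
\<open>n\<close> and \<open>m\<close> are coprime, the numbers \<open>v x\<close> and \<open>v y\<close> are the same multiple of \<open>- n\<close> and
\<open>- m\<close>. The factor \<open>k\<close> will turn out to be \<open>1\<close>, but this uses that the value \<open>1\<close> is attained.\<close>

lemma values_at_pole:
  assumes v: "is_place \<phi> v" and x: "v x < 0"
  obtains k where "k > 0" "v x = - (k * int n)" "v y = - (k * int m)"
proof -
  have eq: "ev y L = \<phi> c * x ^ m" using equation[OF V(3)] by simp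
  have vx: "v (\<phi> c * x ^ m) = int m * v x" "\<phi> c * x ^ m \<noteq> 0"
    using c x_nonzero by (simp_all add: place_mult[OF v] place_power[OF v] place_const[OF v] \<phi>_eq_0_iff)
  have neg: "v y < 0"
  proof (rule ccontr)
    assume "\<not> ?thesis"
    hence "y \<in> integers_of v" by (simp add: integers_of_def)
    hence "\<phi> c * x ^ m \<in> integers_of v"
      using ev_in_subring[OF subring_integers[OF v] constants_integers[OF v], of y L] eq by simp
    hence "v (\<phi> c * x ^ m) \<ge> 0" using vx(2) unfolding integers_of_def by blast
    hence "int m * v x \<ge> 0" using vx(1) by simp
    thus False using m x by (simp add: zero_le_mult_iff)
  qed
  have "L \<noteq> 0" using n_pos by auto
  with place_ev_pole[OF v neg] have "v (ev y L) = int n * v y" by blast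
  hence *: "int n * v y = int m * v x" using vx eq by simp
  have "int n dvd int m * v x" unfolding *[symmetric] by simp
  hence "int n dvd v x" using coprime by (simp add: coprime_dvd_mult_right_iff)
  then obtain l where l: "v x = int n * l" by blast
  hence "int n * v y = int n * (int m * l)" using * by simp
  hence "v y = int m * l" using n_pos by simp
  moreover have "l < 0" using x l n_pos by (simp add: mult_less_0_iff)
  ultimately show thesis using that[of "- l"] l by (simp add: mult.commute)
qed

text \<open>The non-zero terms of \<open>\<Sum>a\<^sub>j y\<^sup>j\<close> with \<open>j < n\<close> have pole orders
\<open>n * degree a\<^sub>j + m * j\<close> up to the factor \<open>k\<close>. These numbers are pairwise incongruent modulo
\<open>n\<close>, so the largest one is the pole order of the sum. The quantifiers are in this order because
\<open>i\<close> and \<open>j\<close> depend on the function only: this is what makes the pole of \<open>x\<close> unique.\<close>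

lemma pole_order:
  assumes r: "r \<in> polys_over Kx" "r \<noteq> 0" "degree r < n"
  shows "\<exists>i j. \<forall>v k. is_place \<phi> v \<longrightarrow> k > 0 \<longrightarrow> v x = - (k * int n) \<longrightarrow> v y = - (k * int m) \<longrightarrow>
           poly r y \<noteq> 0 \<and> v (poly r y) = - (k * int (n * i + m * j))"
proof -
  have "\<exists>g. coeff r i = ev x g" for i using r(1) by (fastforce simp: polys_over_def)
  then obtain M where M: "\<And>i. coeff r i = ev x (M i)" by metis
  define J where "J = {j. j < n \<and> M j \<noteq> 0}"
  have "finite J" by (simp add: J_def)
  moreover have "degree r \<in> J"
    using r M[of "degree r"] by (auto simp: J_def ev_zero)
  moreover define e where "e = (\<lambda>j. n * degree (M j) + m * j)"
  ultimately have "Max (e ` J) \<in> e ` J" and Max_ge: "\<And>i. i \<in> J \<Longrightarrow> e i \<le> Max (e ` J)"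
    by (auto intro: Max_in)
  then obtain j where j: "j \<in> J" "Max (e ` J) = e j" by blast
  have max: "n * degree (M i) + m * i \<le> n * degree (M j) + m * j" if "i \<in> J" for i
    using Max_ge[OF that] j(2) by (simp add: e_def)
  show ?thesis
  proof (rule exI[of _ "degree (M j)"], rule exI[of _ j], intro allI impI)
    fix v k assume v: "is_place \<phi> v" and k: "k > 0" "v x = - (k * int n)" "v y = - (k * int m)"
    have neg: "v x < 0" "v y < 0" using k n_pos m by simp_all
    hence y0: "y \<noteq> 0" using place_zero[OF v] by auto
    define t where "t = (\<lambda>i. ev x (M i) * y ^ i)"
    have t0: "t i = 0 \<longleftrightarrow> M i = 0" for i using y0 by (simp add: t_def ev_x_eq_0_iff)
    have vt: "v (t i) = - (k * int (n * degree (M i) + m * i))" if "M i \<noteq> 0" for i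
      using place_ev_pole[OF v neg(1) that] y0 k
      by (simp add: t_def place_mult[OF v] place_power[OF v] algebra_simps)
    have "poly r y = sum t {..<n}"
      unfolding poly_altdef t_def M[symmetric] using r(3)
      by (intro sum.mono_neutral_left) (auto simp: coeff_eq_0)
    moreover have "sum t {..<n} \<noteq> 0 \<and> v (sum t {..<n}) = v (t j)"
    proof (rule place_dominant_term[OF v])
      show "j \<in> {..<n}" "t j \<noteq> 0" using j by (auto simp: J_def t0)
      fix i assume i: "i \<in> {..<n}" "i \<noteq> j"
      show "t i = 0 \<or> v (t j) < v (t i)"
      proof (cases "M i = 0")
        case False
        hence iJ: "i \<in> J" using i by (simp add: J_def)
        have "n * degree (M i) + m * i \<noteq> n * degree (M j) + m * j"
        proof
          assume eq: "n * degree (M i) + m * i = n * degree (M j) + m * j"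
          have "int n * int (degree (M i)) + int m * int i = int n * int (degree (M j)) + int m * int j"
            using eq by (metis of_nat_add of_nat_mult)
          hence "int m * (int i - int j) = int n * (int (degree (M j)) - int (degree (M i)))"
            by (simp add: algebra_simps)
          hence "int n dvd int m * (int i - int j)" by simp
          hence "int n dvd int i - int j" using coprime by (simp add: coprime_dvd_mult_right_iff)
          moreover have "\<bar>int i - int j\<bar> < int n" using i j by (auto simp: J_def)
          ultimately have "int i - int j = 0" by (metis dvd_imp_le_int abs_of_nat not_less)
          thus False using i(2) by simp
        qed
        hence "n * degree (M i) + m * i < n * degree (M j) + m * j" using max[OF iJ] by simp
        hence "k * int (n * degree (M i) + m * i) < k * int (n * degree (M j) + m * j)"
          using k(1) by (intro mult_strict_left_mono) (simp_all only: of_nat_less_iff)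
        thus ?thesis using vt[OF False] vt[of j] j by (simp add: J_def)
      qed (simp add: t0)
    qed simp
    moreover have "M j \<noteq> 0" using j by (simp add: J_def)
    ultimately show "poly r y \<noteq> 0 \<and> v (poly r y) = - (k * int (n * degree (M j) + m * j))"
      using vt[of j] by metis
  qed
qed

lemma value_formula:
  assumes "f \<noteq> 0"
  shows "\<exists>e. \<forall>v k. is_place \<phi> v \<longrightarrow> k > 0 \<longrightarrow> v x = - (k * int n) \<longrightarrow> v y = - (k * int m) \<longrightarrow> v f = k * e"
proof -
  obtain r b where r: "r \<in> polys_over Kx" "degree r < n" "b \<noteq> 0" "f = poly r y / ev x b"
    using reduced_fraction .
  have "r \<noteq> 0" using r(4) assms by auto
  from pole_order[OF r(1) this r(2)] obtain i j where ij:
    "\<And>v k. is_place \<phi> v \<Longrightarrow> k > 0 \<Longrightarrow> v x = - (k * int n) \<Longrightarrow> v y = - (k * int m) \<Longrightarrow>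
       poly r y \<noteq> 0 \<and> v (poly r y) = - (k * int (n * i + m * j))" by blast
  show ?thesis
  proof (intro exI[of _ "int n * int (degree b) - int (n * i + m * j)"] allI impI)
    fix v k assume v: "is_place \<phi> v" and k: "k > 0" "v x = - (k * int n)" "v y = - (k * int m)"
    have "v x < 0" using k n_pos by simp
    from place_ev_pole[OF v this r(3)] ij[OF v k]
    show "v f = k * (int n * int (degree b) - int (n * i + m * j))"
      unfolding r(4) by (simp add: place_divide[OF v] k(2) algebra_simps)
  qed
qed

text \<open>The factor \<open>k\<close> divides every value, among them \<open>1\<close>.\<close>

lemma normalised_values:
  assumes v: "is_place \<phi> v" and x: "v x < 0"
  shows "v x = - int n" "v y = - int m"
proof -
  obtain k where k: "k > 0" "v x = - (k * int n)" "v y = - (k * int m)" using values_at_pole[OF v x] .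
  obtain f where f: "f \<noteq> 0" "v f = 1" using place_surj[OF v] by blast
  obtain e where "v f = k * e" using value_formula[OF f(1)] v k by blast
  hence "k dvd 1" using f(2) by (metis dvd_triv_left)
  hence "k = 1" using k(1) by simp
  thus "v x = - int n" "v y = - int m" using k by simp_all
qed

lemma pole_of_x_unique:
  assumes v: "is_place \<phi> v" "v x < 0" and w: "is_place \<phi> w" "w x < 0"
  shows "v = w"
proof
  fix f
  show "v f = w f"
  proof (cases "f = 0")
    case False
    obtain e where e: "\<And>v k. is_place \<phi> v \<Longrightarrow> k > 0 \<Longrightarrow> v x = - (k * int n) \<Longrightarrow>
      v y = - (k * int m) \<Longrightarrow> v f = k * e" using value_formula[OF False] by blast
    show ?thesis using e[OF v(1), of 1] e[OF w(1), of 1] normalised_values[OF v] normalised_values[OF w]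
      by simp
  qed (simp add: place_zero[OF v(1)] place_zero[OF w(1)])
qed

lemma powers_of_y_independent:
  assumes "r \<in> polys_over Kx" "degree r < n" "poly r y = 0"
  shows "r = 0"
proof (rule ccontr)
  assume "r \<noteq> 0"
  obtain v where v: "is_place \<phi> v" "v x < 0" using pole_of_x_exists by blast
  show False
    using pole_order[OF assms(1) \<open>r \<noteq> 0\<close> assms(2)] values_at_pole[OF v] v(1) assms(3) by metis
qed

text \<open>Division by \<open>\<Lambda>\<close> leaves a remainder of degree less than \<open>n\<close> that vanishes at \<open>y\<close>, hence is zero.
This does the work of the automorphism of the function field that maps \<open>y\<close> to \<open>y + \<alpha>\<close>.\<close>

lemma conjugate_root:
  assumes "H \<in> polys_over Kx" "poly H y = 0" "\<alpha> \<in> V"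
  shows "poly H (y + \<phi> \<alpha>) = 0"
proof -
  obtain Q r where r: "r \<in> polys_over Kx" "degree r < n" "H = Q * \<Lambda> + r" using reduce[OF assms(1)] .
  have "poly r y = 0" using assms(2) r(3) \<Lambda>_root[OF V(3)] by simp
  hence "r = 0" using powers_of_y_independent r by blast
  thus ?thesis using r(3) \<Lambda>_root[OF assms(3)] by simp
qed

text \<open>Take a denominator of least degree. If it is not constant, then it has a zero at some place over a
prime polynomial \<open>\<pi>\<close>. Regularity there forces \<open>\<pi>\<close> to divide the numerator as well, and
cancelling it gives a smaller denominator.\<close>

lemma regular_rational_function:
  assumes b: "b \<noteq> 0" and reg: "\<And>v. is_place \<phi> v \<Longrightarrow> v x \<ge> 0 \<Longrightarrow> ev x g / ev x b \<in> integers_of v"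
  shows "ev x g / ev x b \<in> Kx"
proof -
  define a where "a = ev x g / ev x b"
  define D where "D = (\<lambda>b. b \<noteq> 0 \<and> a * ev x b \<in> Kx)"
  have "D b" using b by (simp add: D_def a_def ev_x_eq_0_iff)
  then obtain \<beta> where \<beta>: "D \<beta>" and least: "\<And>b. D b \<Longrightarrow> degree \<beta> \<le> degree b"
    using ex_has_least_nat[of D b degree] by blast
  obtain \<gamma> where \<gamma>: "a * ev x \<beta> = ev x \<gamma>" using \<beta> by (auto simp: D_def)
  have \<beta>0: "\<beta> \<noteq> 0" using \<beta> by (simp add: D_def)
  show ?thesis
  proof (cases "degree \<beta> = 0")
    case True
    then obtain s where s: "\<beta> = [:s:]" "s \<noteq> 0" using \<beta>0 by (auto elim: degree_eq_zeroE)
    hence "a = ev x (smult (inverse s) \<gamma>)"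
      using \<gamma>[symmetric] by (simp add: ev_smult ev_const \<phi>_inverse \<phi>_eq_0_iff)
    thus ?thesis by (simp add: a_def)
  next
    case False
    have nonunit: "\<forall>t\<in>Kx. ev x \<beta> * t \<noteq> 1"
    proof (intro ballI notI)
      fix t assume "t \<in> Kx"
      assume eq: "ev x \<beta> * t = 1"
      obtain h where "t = ev x h" using \<open>t \<in> Kx\<close> by blast
      hence "ev x (\<beta> * h) = ev x 1" using eq by (simp add: ev_mult ev_one)
      hence "\<beta> * h = 1" by (simp only: ev_x_inj)
      moreover from this have "h \<noteq> 0" by auto
      ultimately have "degree \<beta> + degree h = 0" using \<beta>0 by (metis degree_1 degree_mult_eq)
      thus False using False by simp
    qed
    have nonzero: "ev x \<beta> \<noteq> 0" using \<beta>0 by (simp add: ev_x_eq_0_iff)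
    obtain R v where R: "valuation_ring R" "Kx \<subseteq> R" "ev x \<beta> \<notin> units R" "is_place \<phi> v"
      "\<forall>f. f \<noteq> 0 \<longrightarrow> (v f \<ge> 0 \<longleftrightarrow> f \<in> R)"
      using place_of_nonunit[OF subring_ev constants_Kx rangeI nonzero nonunit] by blast
    note S = valuation_ring_subring[OF R(1)]
    have xR: "x \<in> R" using R(2) ev_X by (metis rangeI subsetD)
    have cR: "range \<phi> \<subseteq> R" using constants_Kx R(2) by (rule subset_trans)
    obtain \<pi> where \<pi>: "degree \<pi> > 0" "\<And>g. ev x g \<in> units R \<longleftrightarrow> \<not> \<pi> dvd g"
      using centre_generator[OF R(1) cR xR \<beta>0 R(3)] by metis
    have aR: "a \<in> R"
    proof -
      have "v x \<ge> 0" using R(5) x_nonzero xR by simp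
      hence "a \<in> integers_of v" using reg[OF R(4)] by (simp add: a_def)
      thus ?thesis using R(5) subring_zero[OF S] by (cases "a = 0") (auto simp: integers_of_def)
    qed
    have "ev x \<gamma> \<notin> units R"
    proof
      assume "ev x \<gamma> \<in> units R"
      hence "ev x \<beta> * a \<in> units R" using \<gamma> by (simp add: mult.commute)
      moreover have "ev x \<beta> \<in> R" using R(2) by auto
      ultimately show False using units_factor[OF S _ aR] R(3) by blast
    qed
    hence "\<pi> dvd \<gamma>" "\<pi> dvd \<beta>" using \<pi>(2) R(3) by blast+
    then obtain \<gamma>' \<beta>' where fac: "\<gamma> = \<pi> * \<gamma>'" "\<beta> = \<pi> * \<beta>'" by (auto elim!: dvdE)
    have ne: "\<pi> \<noteq> 0" "\<beta>' \<noteq> 0" using \<beta>0 fac by auto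
    have "ev x \<pi> * (a * ev x \<beta>') = ev x \<pi> * ev x \<gamma>'"
      using \<gamma> by (simp add: fac ev_mult mult_ac)
    hence "a * ev x \<beta>' = ev x \<gamma>'" using ne(1) by (simp add: ev_x_eq_0_iff)
    hence "D \<beta>'" using ne by (simp add: D_def)
    hence "degree \<beta> \<le> degree \<beta>'" by (rule least)
    thus ?thesis using fac(2) ne \<pi>(1) by (simp add: degree_mult_eq)
  qed
qed

text \<open>The equation is an integral equation for \<open>f\<close> over \<open>K[x]\<close>, written in terms of \<open>inverse f\<close>. If
there is none, then \<open>inverse f\<close> is not invertible in \<open>K[x, inverse f]\<close>, and \<open>f\<close> has a pole at a
place where \<open>x\<close> is regular.\<close>

lemma integral_of_regular:
  assumes f: "f \<noteq> 0" and reg: "\<forall>v. is_place \<phi> v \<longrightarrow> v x \<ge> 0 \<longrightarrow> v f \<ge> 0"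
  shows "\<exists>g\<in>polys_over Kx. inverse f * poly g (inverse f) = 1"
proof (rule ccontr)
  assume none: "\<not> ?thesis"
  define z where "z = inverse f"
  define A where "A = adjoin Kx z"
  have A: "subring A" "Kx \<subseteq> A" "z \<in> A"
    unfolding A_def using subring_adjoin adjoin_superset adjoin_gen subring_ev by blast+
  have nonunit: "\<forall>a\<in>A. z * a \<noteq> 1"
    using none by (auto simp: A_def adjoin_def z_def)
  have const: "range \<phi> \<subseteq> A" "z \<noteq> 0" using constants_Kx A(2) f by (auto simp: z_def)
  obtain R v where v: "valuation_ring R" "A \<subseteq> R" "z \<notin> units R" "is_place \<phi> v"
    "\<forall>f. f \<noteq> 0 \<longrightarrow> (v f \<ge> 0 \<longleftrightarrow> f \<in> R)" "v z > 0"
    using place_of_nonunit[OF A(1) const(1) A(3) const(2) nonunit] by blast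
  have "x \<in> R" using A(2) v(2) ev_X by (metis rangeI subsetD)
  hence "v x \<ge> 0" using v(5) x_nonzero by simp
  hence "v f \<ge> 0" using reg v(4) by blast
  thus False using v(6) place_inverse[OF v(4) f] by (simp add: z_def)
qed

text \<open>The affine coordinate ring \<open>K[x, y]\<close> is integrally closed. Write \<open>f\<close> as \<open>r(y) / b(x)\<close> with
\<open>r\<close> of degree less than \<open>n\<close>. The conjugates \<open>r(y + \<alpha>) / b(x)\<close> satisfy the same integral
equation as \<open>f\<close>, so they are regular wherever \<open>x\<close> is. The coefficients of \<open>r / b\<close> are
interpolated from these \<open>n\<close> values at points whose differences are constants, so they are regular
there too; being rational functions of \<open>x\<close>, they are polynomials.\<close>

theorem regular_functions:
  assumes f: "f \<noteq> 0" and reg: "\<forall>v. is_place \<phi> v \<longrightarrow> v x \<ge> 0 \<longrightarrow> v f \<ge> 0"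
  obtains r where "r \<in> polys_over Kx" "degree r < n" "f = poly r y"
proof -
  obtain g where g: "g \<in> polys_over Kx" "inverse f * poly g (inverse f) = 1"
    using integral_of_regular[OF f reg] by blast
  obtain r b where r: "r \<in> polys_over Kx" "degree r < n" "b \<noteq> 0" "f = poly r y / ev x b"
    using reduced_fraction .
  define B where "B = ev x b"
  have B: "B \<noteq> 0" "B \<in> Kx" using r(3) by (auto simp: B_def ev_x_eq_0_iff)
  define d where "d = degree g"
  \<comment> \<open>\<open>H(t) = 0\<close> is the integral equation for \<open>r(t) / b\<close> with the denominators cleared.\<close>
  define H where "H = r ^ Suc d - (\<Sum>i\<le>d. smult (coeff g i * B ^ Suc i) (r ^ (d - i)))"
  have H: "H \<in> polys_over Kx" unfolding H_def
    using r(1) g(1) B(2)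
    by (intro polys_over_diff polys_over_power polys_over_sum polys_over_smult subring_mult
        subring_power subring_ev) (auto simp: polys_over_def)
  have H_eval: "poly H t = poly r t ^ Suc d * (1 - B / poly r t * poly g (B / poly r t))"
    if nz: "poly r t \<noteq> 0" for t
  proof -
    have "poly r t ^ Suc d * (B / poly r t * poly g (B / poly r t))
        = (\<Sum>i\<le>d. poly r t ^ Suc d * (B / poly r t * (coeff g i * (B / poly r t) ^ i)))"
      by (simp add: poly_altdef d_def sum_distrib_left)
    also have "\<dots> = (\<Sum>i\<le>d. coeff g i * B ^ Suc i * poly r t ^ (d - i))"
    proof (intro sum.cong refl)
      fix i assume "i \<in> {..d}"
      hence "poly r t ^ d = poly r t ^ (d - i) * poly r t ^ i" by (simp flip: power_add)
      thus "poly r t ^ Suc d * (B / poly r t * (coeff g i * (B / poly r t) ^ i))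
          = coeff g i * B ^ Suc i * poly r t ^ (d - i)"
        using nz by (simp add: power_divide field_simps)
    qed
    finally show ?thesis by (simp add: H_def poly_sum poly_power right_diff_distrib)
  qed
  have "poly H y = 0"
  proof -
    have "poly r y \<noteq> 0" "inverse f = B / poly r y" using f r(4) by (auto simp: B_def)
    thus ?thesis using H_eval[of y] g(2) by simp
  qed
  hence conj: "poly H (y + \<phi> \<alpha>) = 0" if "\<alpha> \<in> V" for \<alpha> using conjugate_root[OF H] that by blast
  have integral: "coeff r i / B \<in> integers_of v" if v: "is_place \<phi> v" "v x \<ge> 0" for v i
  proof -
    note S = subring_integers[OF v(1)]
    have Kx_int: "Kx \<subseteq> integers_of v"
      using ev_in_subring[OF S constants_integers[OF v(1)], of x] v(2) by (auto simp: integers_of_def)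
    have y_int: "y \<in> integers_of v" using finite_at_y[OF v] by (simp add: integers_of_def)
    have "poly r t / B \<in> integers_of v" if t: "t = y + \<phi> \<alpha>" "\<alpha> \<in> V" for t \<alpha>
    proof (rule ccontr)
      assume not_int: "\<not> ?thesis"
      hence nz: "poly r t \<noteq> 0" by (auto simp: integers_of_def)
      define z where "z = B / poly r t"
      have z: "z \<noteq> 0" "v z > 0"
        using not_int nz B(1) by (auto simp: z_def integers_of_def place_divide[OF v(1)])
      have "z * poly g z = 1" using H_eval[OF nz] conj[OF t(2)] nz t(1) by (simp add: z_def)
      moreover have "poly g z \<in> integers_of v"
        using g(1) Kx_int z by (intro poly_in_subring S) (auto simp: polys_over_def integers_of_def)
      ultimately show False
        using z place_mult[OF v(1), of z "poly g z"] place_one[OF v(1)]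
        by (cases "poly g z = 0") (auto simp: integers_of_def)
    qed
    hence "poly (smult (inverse B) r) t \<in> integers_of v" if "t \<in> (\<lambda>\<alpha>. y + \<phi> \<alpha>) ` V" for t
      using that by (auto simp: divide_inverse mult.commute)
    moreover have "inverse (s - t) \<in> integers_of v"
      if st: "s \<in> (\<lambda>\<alpha>. y + \<phi> \<alpha>) ` V" "t \<in> (\<lambda>\<alpha>. y + \<phi> \<alpha>) ` V" for s t
    proof -
      obtain \<alpha> \<beta> where "s = y + \<phi> \<alpha>" "t = y + \<phi> \<beta>" using st by blast
      hence "s - t = \<phi> (\<alpha> - \<beta>)" by (simp add: \<phi>_diff)
      hence "inverse (s - t) \<in> range \<phi>" by (metis \<phi>_inverse rangeI)
      thus ?thesis using constants_integers[OF v(1)] by blast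
    qed
    moreover have "(\<lambda>\<alpha>. y + \<phi> \<alpha>) ` V \<subseteq> integers_of v"
      using y_int constants_integers[OF v(1)] subring_add[OF S] by blast
    moreover have "card ((\<lambda>\<alpha>. y + \<phi> \<alpha>) ` V) = n"
      using V(2) inj_\<phi> by (subst card_image) (auto simp: inj_on_def)
    moreover have "degree (smult (inverse B) r) < n" using r(2) by simp
    ultimately have "smult (inverse B) r \<in> polys_over (integers_of v)"
      using V(1) by (intro coeffs_from_values[OF S, of "(\<lambda>\<alpha>. y + \<phi> \<alpha>) ` V"]) auto
    thus ?thesis by (simp add: polys_over_def divide_inverse mult.commute)
  qed
  have "coeff r i / B \<in> Kx" for i
  proof -
    obtain a where "coeff r i = ev x a" using r(1) by (auto simp: polys_over_def) 
    thus ?thesis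
      using regular_rational_function[OF r(3), of a] integral[of _ i] by (simp add: B_def)
  qed
  hence "smult (inverse B) r \<in> polys_over Kx" by (simp add: polys_over_def divide_inverse mult.commute)
  moreover have "f = poly (smult (inverse B) r) y" using r(4) by (simp add: B_def divide_inverse mult.commute)
  moreover have "degree (smult (inverse B) r) < n" using r(2) by simp
  ultimately show thesis using that by blast
qed

end

section \<open>The Weierstrass semigroup at the pole of x\<close>

lemma semigroup_generated_two:
  "semigroup_generated {a, b} = {a * i + b * j | i j. True}" (is "_ = ?W")
proof
  show "semigroup_generated {a, b} \<subseteq> ?W"
    unfolding semigroup_generated_def
  proof (rule hull_minimal)
    have "a = a * 1 + b * 0" "b = a * 0 + b * 1" by auto
    thus "{a, b} \<subseteq> ?W" by blast
    have "0 = a * 0 + b * 0" by simp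
    hence "0 \<in> ?W" by blast
    moreover have "s + t \<in> ?W" if st: "s \<in> ?W" "t \<in> ?W" for s t
    proof -
      obtain i j i' j' where "s = a * i + b * j" "t = a * i' + b * j'" using st by blast
      hence "s + t = a * (i + i') + b * (j + j')" by (simp add: algebra_simps)
      thus ?thesis by blast
    qed
    ultimately show "0 \<in> ?W \<and> (\<forall>s\<in>?W. \<forall>t\<in>?W. s + t \<in> ?W)" by blast
  qed
next
  show "?W \<subseteq> semigroup_generated {a, b}"
    unfolding semigroup_generated_def hull_def
  proof (intro Inter_greatest)
    fix T assume "T \<in> {T. (0 \<in> T \<and> (\<forall>a\<in>T. \<forall>b\<in>T. a + b \<in> T)) \<and> {a, b} \<subseteq> T}"
    hence T: "0 \<in> T" "\<And>s t. s \<in> T \<Longrightarrow> t \<in> T \<Longrightarrow> s + t \<in> T" "a \<in> T" "b \<in> T" by auto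
    have mult: "s * i \<in> T" if "s \<in> T" for s i :: nat
      by (induction i) (auto simp: T that)
    show "?W \<subseteq> T" using T mult by auto
  qed
qed

context translation_curve begin

lemma common_pole_iff: "common_pole \<phi> x y v \<longleftrightarrow> is_place \<phi> v \<and> v x < 0"
  using normalised_values(2)[of v] m by (auto simp: common_pole_def)

theorem unique_common_pole: "\<exists>!P. common_pole \<phi> x y P"
  unfolding common_pole_iff using pole_of_x_exists pole_of_x_unique by blast

text \<open>A function whose only pole is \<open>P\<close> is a polynomial in \<open>x\<close> and \<open>y\<close>, and its pole order is that of
its dominant monomial. Conversely the monomials \<open>x ^ i * y ^ j\<close> have no other pole than \<open>P\<close>.\<close>

theorem weierstrass_semigroup_at_infinity:
  assumes P: "common_pole \<phi> x y P"
  shows "weierstrass_semigroup \<phi> P = semigroup_generated {n, m}"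
  unfolding semigroup_generated_two
proof (intro subset_antisym subsetI)
  have P': "is_place \<phi> P" "P x < 0" using P by (simp_all add: common_pole_iff)
  note vals = normalised_values[OF P']
  {
    fix N assume "N \<in> weierstrass_semigroup \<phi> P"
    then obtain f where f: "f \<noteq> 0" "pole_divisor \<phi> f = (\<lambda>v. if v = P then N else 0)"
      by (auto simp: weierstrass_semigroup_def)
    have N: "N = nat (- P f)" using fun_cong[OF f(2), of P] P'(1) by (simp add: pole_divisor_def)
    have "\<forall>v. is_place \<phi> v \<longrightarrow> v x \<ge> 0 \<longrightarrow> v f \<ge> 0"
    proof (intro allI impI)
      fix v assume "is_place \<phi> v" "v x \<ge> 0"
      thus "v f \<ge> 0"
        using fun_cong[OF f(2), of v] P'(2) by (auto simp: pole_divisor_def split: if_splits)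
    qed
    from regular_functions[OF f(1) this]
    obtain r where r: "r \<in> polys_over Kx" "degree r < n" "f = poly r y" .
    have "r \<noteq> 0" using f(1) r(3) by auto
    from pole_order[OF r(1) this r(2)] obtain i j where
      "\<And>v k. is_place \<phi> v \<Longrightarrow> k > 0 \<Longrightarrow> v x = - (k * int n) \<Longrightarrow> v y = - (k * int m) \<Longrightarrow>
         v (poly r y) = - (k * int (n * i + m * j))" by blast
    from this[OF P'(1), of 1] have "P f = - int (n * i + m * j)" using vals r(3) by simp
    hence "N = n * i + m * j" using N by (simp only: minus_minus nat_int)
    thus "N \<in> {n * i + m * j | i j. True}" by blast
  next
    fix N assume "N \<in> {n * i + m * j | i j. True}"
    then obtain i j where N: "N = n * i + m * j" by blast
    have y0: "y \<noteq> 0" using vals(2) m place_zero[OF P'(1)] by auto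
    define f where "f = x ^ i * y ^ j"
    have vf: "v f = int i * v x + int j * v y" if "is_place \<phi> v" for v
      using that x_nonzero y0 by (simp add: f_def place_mult place_power)
    have "pole_divisor \<phi> f v = (if v = P then N else 0)" for v
    proof -
      consider "v = P" | "v \<noteq> P" "is_place \<phi> v" | "v \<noteq> P" "\<not> is_place \<phi> v" by blast
      thus ?thesis
      proof cases
        case 1
        have "- P f = int N" unfolding vf[OF P'(1)] vals N by (simp add: algebra_simps)
        thus ?thesis using 1 P'(1) by (simp add: pole_divisor_def)
      next
        case 2
        hence "v x \<ge> 0" using pole_of_x_unique[OF _ _ P'] by force
        hence "v f \<ge> 0" unfolding vf[OF 2(2)] using finite_at_y[OF 2(2)] by simp
        thus ?thesis using 2 by (simp add: pole_divisor_def)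
      qed (simp add: pole_divisor_def)
    qed
    moreover have "f \<noteq> 0" using x_nonzero y0 by (simp add: f_def)
    ultimately show "N \<in> weierstrass_semigroup \<phi> P" by (auto simp: weierstrass_semigroup_def)
  }
qed

end

section \<open>The trace polynomial over a finite field\<close>

text \<open>Multiplication by \<open>a \<noteq> 0\<close> permutes the non-zero elements and so preserves their product.\<close>

lemma power_card_field:
  fixes a :: "'k::field"
  assumes fin: "finite (UNIV :: 'k set)"
  shows "a ^ CARD('k) = a"
proof (cases "a = 0")
  case False
  have "bij_betw ((*) a) (UNIV - {0}) (UNIV - {0})"
    using False by (intro bij_betwI[where g = "\<lambda>b. b / a"]) auto
  hence "(\<Prod>b\<in>UNIV - {0}. a * b) = \<Prod>(UNIV - {0})"
    by (rule prod.reindex_bij_betw[where g = "\<lambda>b. b"])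
  hence "a ^ (CARD('k) - 1) * \<Prod>(UNIV - {0}) = 1 * (\<Prod>(UNIV - {0}) :: 'k)"
    using fin by (simp add: prod.distrib)
  moreover have "\<Prod>(UNIV - {0}) \<noteq> (0::'k)" using fin by simp
  ultimately have "a ^ (CARD('k) - 1) = 1" by (metis mult_right_cancel)
  moreover have "CARD('k) = Suc (CARD('k) - 1)" using finite_UNIV_card_ge_0[OF fin] by simp
  ultimately show ?thesis by (metis mult.right_neutral power_Suc)
qed (use finite_UNIV_card_ge_0[OF fin] in \<open>auto simp: power_0_left\<close>)

text \<open>Translation by \<open>1\<close> permutes the field and so preserves the sum of its elements; hence the number of
elements is zero in the field.\<close>

lemma CHAR_of_prime_power_card:
  assumes p: "prime p" and card: "CARD('k::field) = p ^ k"
  shows "CHAR('k) = p"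
proof -
  have fin: "finite (UNIV :: 'k set)" using p card by (metis card.infinite power_not_zero prime_gt_0_nat not_gr0)
  have "(\<Sum>b\<in>UNIV. b + 1) = (\<Sum>b\<in>UNIV. b :: 'k)"
    by (rule sum.reindex_bij_witness[of _ "\<lambda>b. b - 1" "\<lambda>b. b + 1"]) auto
  hence "of_nat CARD('k) = (0::'k)" using fin by (simp add: sum.distrib)
  hence "CHAR('k) dvd p ^ k" unfolding card by (simp only: of_nat_eq_0_iff_char_dvd)
  moreover have "prime CHAR('k)" using fin finite_imp_CHAR_pos prime_CHAR_semidom by blast
  ultimately show ?thesis using p by (metis prime_dvd_power_nat primes_dvd_imp_eq)
qed

text \<open>On a field with \<open>p ^ h\<close> elements this polynomial is the trace to the prime field.\<close>

definition trace_poly :: "nat \<Rightarrow> nat \<Rightarrow> 'k::field poly" where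
  "trace_poly p h = (\<Sum>j<h. monom 1 (p ^ j))"

lemma poly_trace_poly: "poly (trace_poly p h) a = (\<Sum>j<h. a ^ p ^ j)"
  by (simp add: trace_poly_def poly_sum poly_monom)

lemma trace_poly_degree:
  assumes p: "p > 1" and h: "h > 0"
  shows "degree (trace_poly p h :: 'k::field poly) = p ^ (h - 1)"
    and "lead_coeff (trace_poly p h :: 'k poly) = 1"
proof -
  obtain k where k: "h = Suc k" using h by (cases h) auto
  have "degree (trace_poly p k :: 'k poly) < p ^ k"
  proof (cases k)
    case (Suc l)
    have "degree (trace_poly p k :: 'k poly) \<le> p ^ l"
      unfolding trace_poly_def using p Suc
      by (intro degree_sum_le) (auto intro!: order.trans[OF degree_monom_le] power_increasing)
    also have "\<dots> < p ^ k" using p Suc by simp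
    finally show ?thesis .
  qed (simp add: trace_poly_def)
  hence lt: "degree (trace_poly p k :: 'k poly) < degree (monom 1 (p ^ k) :: 'k poly)"
    by (simp add: degree_monom_eq)
  have split: "trace_poly p h = trace_poly p k + monom (1::'k) (p ^ k)"
    by (simp add: k trace_poly_def)
  show "degree (trace_poly p h :: 'k poly) = p ^ (h - 1)"
    unfolding split degree_add_eq_right[OF lt] by (simp add: degree_monom_eq k)
  show "lead_coeff (trace_poly p h :: 'k poly) = 1"
    unfolding split lead_coeff_add_le[OF lt] by (simp add: degree_monom_eq)
qed

lemma trace_poly_add:
  assumes "prime p" "CHAR('f::field) = p"
  shows "(\<Sum>j<h. (a + b :: 'f) ^ p ^ j) = (\<Sum>j<h. a ^ p ^ j) + (\<Sum>j<h. b ^ p ^ j)"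
proof -
  have "(a + b) ^ p ^ j = a ^ p ^ j + b ^ p ^ j" for j
    using assms by (intro freshmans_dream') auto
  thus ?thesis by (simp add: sum.distrib)
qed

text \<open>The map \<open>T\<close> given by the polynomial is additive. Its kernel has at most \<open>p ^ (h - 1)\<close> elements by
degree. A value \<open>c = T a\<close> satisfies \<open>c ^ p - c = a ^ q - a\<close> with \<open>q = p ^ h\<close>, and
\<open>b = a ^ q - a\<close> satisfies \<open>b ^ q + b = 0\<close> because of \<open>a ^ (q ^ 2) = a\<close>; so \<open>c\<close> is a root of a
polynomial of degree \<open>p * q\<close>. Since kernel and image account for \<open>q ^ 2\<close> elements, the kernel
has at least \<open>q / p\<close> of them.\<close>

lemma card_roots_trace_poly:
  assumes p: "prime p" and h: "h > 0" and card: "CARD('k::field) = (p ^ h) ^ 2"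
  shows "card {a :: 'k. poly (trace_poly p h) a = 0} = p ^ (h - 1)" (is "card ?V = _")
proof (rule antisym)
  have p1: "p > 1" using p by (rule prime_gt_1_nat)
  have fin: "finite (UNIV :: 'k set)" using p card by (metis card.infinite power_not_zero prime_gt_0_nat not_gr0)
  have char: "CHAR('k) = p"
    using CHAR_of_prime_power_card[OF p, of "h * 2"] card by (simp add: power_mult)
  define q where "q = p ^ h"
  have q1: "q > 1" unfolding q_def using p1 h by (rule one_less_power)
  have ne: "trace_poly p h \<noteq> (0 :: 'k poly)"
    using trace_poly_degree(2)[OF p1 h, where ?'k = 'k] by auto
  show "card ?V \<le> p ^ (h - 1)"
    using card_poly_roots_bound[OF ne] trace_poly_degree(1)[OF p1 h, where ?'k = 'k] by simp
  define T where "T = (\<lambda>a::'k. poly (trace_poly p h) a)"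
  have T: "T a = (\<Sum>j<h. a ^ p ^ j)" for a by (simp add: T_def poly_trace_poly)
  have T_add: "T (a + b) = T a + T b" for a b unfolding T using p char by (rule trace_poly_add)
  have pow_q_diff: "(a - b) ^ q = a ^ q - b ^ q" for a b :: 'k
  proof -
    have "(a - b + b) ^ q = (a - b) ^ q + b ^ q"
      using p char by (intro freshmans_dream') (auto simp: q_def)
    thus ?thesis by (simp add: algebra_simps)
  qed
  have T_p: "T a ^ p - T a = a ^ q - a" for a
  proof -
    have "T a ^ p = (\<Sum>j<h. (a ^ p ^ j) ^ p)"
      unfolding T using p char by (intro freshmans_dream_sum) auto
    also have "\<dots> = (\<Sum>j<h. a ^ p ^ Suc j)" by (simp flip: power_mult add: mult.commute)
    finally have "T a ^ p - T a = (\<Sum>j<h. a ^ p ^ Suc j - a ^ p ^ j)"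
      by (simp add: T sum_subtractf)
    also have "\<dots> = a ^ q - a" by (subst sum_lessThan_telescope) (simp add: q_def)
    finally show ?thesis .
  qed
  define U :: "'k poly" where "U = monom 1 p - monom 1 1"
  define W where "W = U ^ q + U"
  have "degree U = p" unfolding U_def diff_conv_add_uminus
    using p1 by (subst degree_add_eq_left) (auto simp: degree_monom_eq)
  moreover from this have "U \<noteq> 0" using p1 by auto
  ultimately have "degree (U ^ q) = q * p" "degree U < q * p"
    using p1 q1 by (auto simp: degree_power_eq)
  hence W: "degree W = q * p" unfolding W_def by (simp add: degree_add_eq_left)
  hence "W \<noteq> 0" using p1 q1 by auto
  hence image: "card {c. poly W c = 0} \<le> q * p" "finite {c. poly W c = 0}"
    using card_poly_roots_bound[of W] W poly_roots_finite by auto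
  have "poly W (T a) = 0" for a
  proof -
    have "(a ^ q - a) ^ q + (a ^ q - a) = (a ^ q) ^ q - a"
      unfolding pow_q_diff by simp
    also have "(a ^ q) ^ q = a ^ CARD('k)" by (simp add: card q_def power2_eq_square power_mult)
    finally show ?thesis
      by (simp add: W_def U_def poly_monom T_p power_card_field[OF fin])
  qed
  hence "range T \<subseteq> {c. poly W c = 0}" by blast
  hence range: "card (range T) \<le> q * p" using image card_mono order.trans by blast
  have fibre: "card {a. T a = c} \<le> card ?V" if "c \<in> range T" for c
  proof -
    obtain b where b: "c = T b" using \<open>c \<in> range T\<close> by blast
    have "{a. T a = c} \<subseteq> (+) b ` ?V"
    proof
      fix a assume "a \<in> {a. T a = c}"
      hence "T (a - b) = 0" using T_add[of "a - b" b] b by simp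
      thus "a \<in> (+) b ` ?V" by (intro image_eqI[of _ _ "a - b"]) (auto simp: T_def)
    qed
    moreover have V: "finite ?V" using fin by (rule finite_subset[OF subset_UNIV])
    ultimately have "card {a. T a = c} \<le> card ((+) b ` ?V)" by (intro card_mono finite_imageI)
    also have "\<dots> \<le> card ?V" using V by (rule card_image_le)
    finally show ?thesis .
  qed
  have "q ^ 2 = card (\<Union>c\<in>range T. {a. T a = c})"
  proof -
    have "(\<Union>c\<in>range T. {a. T a = c}) = UNIV" by auto
    thus ?thesis using card by (simp only: q_def)
  qed
  also have "\<dots> \<le> (\<Sum>c\<in>range T. card {a. T a = c})"
    using finite_imageI[OF fin] by (rule card_UN_le)
  also have "\<dots> \<le> (\<Sum>c\<in>range T. card ?V)" by (intro sum_mono fibre)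
  also have "\<dots> \<le> q * p * card ?V" using range by simp
  finally have "q * q \<le> q * (p * card ?V)" by (simp add: power2_eq_square mult.assoc)
  hence "q \<le> p * card ?V" using q1 by simp
  moreover have "q = p * p ^ (h - 1)" using h by (cases h) (auto simp: q_def)
  ultimately show "p ^ (h - 1) \<le> card ?V" using p1 by simp
qed

text \<open>Over the field with \<open>q ^ 2\<close> elements the trace polynomial has \<open>q / p\<close> roots \<open>\<alpha>\<close>, and by
additivity the equation is invariant under the translations \<open>y \<mapsto> y + \<alpha>\<close>. The exponent
\<open>m\<close> is prime to \<open>p\<close> as a divisor of \<open>q + 1\<close>.\<close>

lemma weierstrass_semigroup_trace_curve:
  fixes \<phi> :: "'k::field \<Rightarrow> 'f::field"
  assumes p: "prime p" and h: "h > 0" and q: "q = p ^ h" and card: "CARD('k) = q ^ 2"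
    and \<omega>: "\<omega> \<noteq> 0" and m: "m > 0" "m dvd q + 1"
    and ff: "function_field_in \<phi> x y"
    and eq: "(\<Sum>i=1..h. y ^ (q div p ^ i)) + \<phi> \<omega> * x ^ m = 0"
  shows "(\<exists>!P. common_pole \<phi> x y P) \<and>
    (\<forall>P. common_pole \<phi> x y P \<longrightarrow> weierstrass_semigroup \<phi> P = semigroup_generated {q div p, m})"
proof -
  interpret constant_field \<phi> using ff by unfold_locales (simp add: function_field_in_def)
  have p1: "p > 1" using p by (rule prime_gt_1_nat)
  define L :: "'k poly" where "L = trace_poly p h"
  define V where "V = {a :: 'k. poly L a = 0}"
  have fin: "finite (UNIV :: 'k set)" using card q p by (metis card.infinite power_not_zero prime_gt_0_nat not_gr0)
  have L: "degree L = p ^ (h - 1)" "lead_coeff L = 1"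
    using trace_poly_degree[OF p1 h, where ?'k = 'k] by (simp_all add: L_def)
  have charK: "CHAR('k) = p"
    using CHAR_of_prime_power_card[OF p, of "h * 2"] card by (simp add: q power_mult)
  have of_nat: "\<phi> (of_nat k) = of_nat k" for k by (induction k) (simp_all add: \<phi>_add \<phi>_one)
  have charF: "CHAR('f) = p"
  proof (rule CHAR_eqI)
    have "of_nat k = (0::'f) \<longleftrightarrow> p dvd k" for k
      unfolding of_nat[symmetric] \<phi>_eq_0_iff of_nat_eq_0_iff_char_dvd charK ..
    thus "of_nat p = (0::'f)" "\<And>k. of_nat k = (0::'f) \<Longrightarrow> p dvd k" by auto
  qed
  have ev_L: "ev t L = (\<Sum>j<h. t ^ p ^ j)" for t
    by (simp add: L_def trace_poly_def ev_sum ev_monom \<phi>_one)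
  have q_div: "q div p ^ i = p ^ (h - i)" if "i \<le> h" for i
    using that p1 unfolding q by (simp add: power_diff)
  have "(\<Sum>i=1..h. y ^ (q div p ^ i)) = ev y L"
    unfolding ev_L
    by (rule sum.reindex_bij_witness[of _ "\<lambda>j. h - j" "\<lambda>i. h - i"]) (auto simp: q_div)
  hence "ev y L = \<phi> (- \<omega>) * x ^ m" using eq by (simp add: \<phi>_uminus eq_neg_iff_add_eq_0)
  moreover have "ev (y + \<phi> \<alpha>) L = ev y L" if "\<alpha> \<in> V" for \<alpha>
  proof -
    have "ev (\<phi> \<alpha>) L = \<phi> (poly L \<alpha>)"
    proof -
      have "\<phi> (sum g I) = (\<Sum>i\<in>I. \<phi> (g i))" for g and I :: "nat set"
        by (induction I rule: infinite_finite_induct) (auto simp: \<phi>_add)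
      thus ?thesis unfolding ev_L by (simp add: L_def poly_trace_poly \<phi>_power)
    qed
    hence "ev (\<phi> \<alpha>) L = 0" using that by (simp add: V_def)
    moreover have "ev (y + \<phi> \<alpha>) L = ev y L + ev (\<phi> \<alpha>) L"
      unfolding ev_L using p charF by (rule trace_poly_add)
    ultimately show ?thesis by simp
  qed
  moreover have "card V = degree L"
    unfolding V_def L(1) using card_roots_trace_poly[OF p h] card by (simp add: L_def q)
  moreover have "0 \<in> V" using p1 by (simp add: V_def L_def poly_trace_poly power_0_left)
  moreover have "coprime (degree L) m"
  proof -
    have "\<not> p dvd m"
    proof
      assume "p dvd m"
      hence "p dvd q + 1" using m(2) by (rule dvd_trans)
      moreover have "p dvd q" using h by (simp add: q)
      ultimately have "p dvd 1" by (metis dvd_add_right_iff)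
      thus False using p1 by simp
    qed
    hence "coprime p m" using p by (simp add: prime_imp_coprime)
    thus ?thesis unfolding L(1) by simp
  qed
  ultimately interpret translation_curve \<phi> x y L "- \<omega>" m V
    using ff \<omega> m(1) L(2) fin
    by unfold_locales (auto simp: function_field_in_def intro: finite_subset[OF subset_UNIV])
  have "degree L = q div p" using q_div[of 1] h L(1) by simp
  thus ?thesis using unique_common_pole weierstrass_semigroup_at_infinity by simp
qed

theorem proposition19:
  fixes p h q :: nat and \<omega> :: "'k::field" and \<phi> :: "'k \<Rightarrow> 'f::field"
  assumes "prime p" and "q = p ^ h"
    and "CARD('k) = q ^ 2"
    and "\<omega> ^ (q - 1) = -1"
  shows "(h \<ge> 2 \<longrightarrow>
      (\<forall>x y. function_field_in \<phi> x y \<longrightarrow>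
        (\<Sum>i=1..h. y ^ (q div p ^ i)) + \<phi> \<omega> * x ^ (q + 1) = 0 \<longrightarrow>
        (\<exists>!P. common_pole \<phi> x y P) \<and>
        (\<forall>P. common_pole \<phi> x y P \<longrightarrow>
          weierstrass_semigroup \<phi> P = semigroup_generated {q div p, q + 1}))) \<and>
    (\<forall>d. prime d \<longrightarrow> d \<noteq> p \<longrightarrow> d dvd q + 1 \<longrightarrow>
      (\<forall>x y. function_field_in \<phi> x y \<longrightarrow>
        (\<Sum>i=1..h. y ^ (q div p ^ i)) + \<phi> \<omega> * x ^ ((q + 1) div d) = 0 \<longrightarrow>
        (\<exists>!P. common_pole \<phi> x y P) \<and>
        (\<forall>P. common_pole \<phi> x y P \<longrightarrow>
          weierstrass_semigroup \<phi> P = semigroup_generated {q div p, (q + 1) div d})))"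
proof -
  have p1: "p > 1" using assms(1) by (rule prime_gt_1_nat)
  have h: "h > 0"
  proof (rule ccontr)
    assume "\<not> ?thesis"
    \<comment> \<open>For \<open>h = 0\<close> the field would have a single element.\<close>
    hence "CARD('k) = 1" using assms(2,3) by simp
    then obtain a :: 'k where "UNIV = {a}" by (auto simp: card_1_singleton_iff)
    hence "(0::'k) = 1" by (metis UNIV_I singletonD)
    thus False by simp
  qed
  have "q > 1" unfolding assms(2) using p1 h by (rule one_less_power)
  hence \<omega>: "\<omega> \<noteq> 0" using assms(4) by (auto simp: power_0_left)
  note curve = weierstrass_semigroup_trace_curve[OF assms(1) h assms(2,3) \<omega>]
  have quotient: "(q + 1) div d > 0" "(q + 1) div d dvd q + 1" if "d dvd q + 1" for d
  proof -
    have eq: "q + 1 = (q + 1) div d * d" using that by simp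
    thus "(q + 1) div d > 0" by (metis add_is_0 gr0I mult_0 zero_neq_one)
    show "(q + 1) div d dvd q + 1" using eq by (metis dvd_triv_left)
  qed
  have a: "q + 1 > 0" by simp
  show ?thesis
    by (intro conjI[OF impI] allI impI) (rule curve[OF a dvd_refl] curve[OF quotient], assumption+)+
qed

end
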